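(* Let $\mathcal{A},\mathcal{B},\mathcal{C}$ be extriangulated categories and let $(\mathcal{A},\mathcal{B},\mathcal{C})$ be a recollement of extriangulated categories, given by functors $i^{*},i^{!}\colon\mathcal{B}\to\mathcal{A}$, $i_{*}\colon\mathcal{A}\to\mathcal{B}$, $j^{*}\colon\mathcal{B}\to\mathcal{C}$, $j_{!},j_{*}\colon\mathcal{C}\to\mathcal{B}$. Let $(\mathcal{T}_{1},\mathcal{F}_{1})$ and $(\mathcal{T}_{2},\mathcal{F}_{2})$ be torsion pairs in $\mathcal{A}$ and $\mathcal{C}$, respectively. Define full subcategories of $\mathcal{B}$ by $$\mathcal{T}=\{B\in\mathcal{B}\mid i^{*}B\in\mathcal{T}_{1}\text{ and }j^{*}B\in\mathcal{T}_{2}\},\qquad \mathcal{F}=\{B\in\mathcal{B}\mid i^{!}B\in\mathcal{F}_{1}\text{ and }j^{*}B\in\mathcal{F}_{2}\}.$$ Then: (1) If $i^{!}$ and $i^{*}$ are exact, then $(\mathcal{T},\mathcal{F})$ is a torsion pair in $\mathcal{B}$. (2) $(\mathcal{T}_{1},\mathcal{F}_{1})=(i^{*}\mathcal{T},i^{!}\mathcal{F})$ and $(\mathcal{T}_{2},\mathcal{F}_{2})=(j^{*}\mathcal{T},j^{*}\mathcal{F})$.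
   Context: **Extriangulated categories (Nakaoka–Palu).** Let $\mathcal{C}$ be an additive category with an additive bifunctor $\mathbb{E}\colon\mathcal{C}^{op}\times\mathcal{C}\to \mathrm{Ab}$. Elements $\delta\in\mathbb{E}(C,A)$ are called $\mathbb{E}$-extensions; for $a\colon A\to A'$ and $c\colon C'\to C$ write $a_*\delta=\mathbb{E}(C,a)(\delta)$, $c^*\delta=\mathbb{E}(c,A)(\delta)$. A morphism from $\delta\in\mathbb{E}(C,A)$ to $\delta'\in\mathbb{E}(C',A')$ is a pair $(a\colon A\to A',c\colon C\to C')$ with $a_*\delta=c^*\delta'$. Two sequences $A\to B\to C$ and $A\to B'\to C$ are equivalent if there is an isomorphism $B\cong B'$ compatible with the maps from $A$ and to $C$. A realization $\mathfrak{s}$ assigns to each $\delta\in\mathbb{E}(C,A)$ an equivalence class $\mathfrak{s}(\delta)=[A\xrightarrow{x}B\xrightarrow{y}C]$ such that for every morphism $(a,c)\colon\delta\to\delta'$, with $\mathfrak{s}(\delta')=[A'\xrightarrow{x'}B'\xrightarrow{y'}C']$, there is $b\colon B\to B'$ with $bx=x'a$, $y'b=cy$. It is additive if $\mathfrak{s}(0)=[A\to A\oplus C\to C]$ (the split sequence) and $\mathfrak{s}(\delta\oplus\delta')=\mathfrak{s}(\delta)\oplus\mathfrak{s}(\delta')$. The triple $(\mathcal{C},\mathbb{E},\mathfrak{s})$ is an extriangulated category if $\mathbb{E}$ is an additive bifunctor, $\mathfrak{s}$ is an additive realization and the following hold. (ET3) If $\mathfrak{s}(\delta)=[A\xrightarrow{x}B\xrightarrow{y}C]$,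 $\mathfrak{s}(\delta')=[A'\xrightarrow{x'}B'\xrightarrow{y'}C']$ and $bx=x'a$, then there is $c\colon C\to C'$ with $cy=y'b$ and $a_*\delta=c^*\delta'$. (ET3)$^{op}$: the dual. (ET4) If $A\xrightarrow{f}B\xrightarrow{f'}D$ realizes $\delta$ and $B\xrightarrow{g}C\xrightarrow{g'}F$ realizes $\delta'$, then there are an object $E$, morphisms $h'\colon C\to E$, $d\colon D\to E$, $e\colon E\to F$ and $\delta''\in\mathbb{E}(E,A)$ realized by $A\xrightarrow{gf}C\xrightarrow{h'}E$ such that $df'=h'g$, $eh'=g'$, $D\xrightarrow{d}E\xrightarrow{e}F$ realizes $f'_*\delta'$, $d^*\delta''=\delta$ and $f_*\delta''=e^*\delta'$. (ET4)$^{op}$: the dual. A sequence $A\xrightarrow{x}B\xrightarrow{y}C$ realizing some $\delta\in\mathbb{E}(C,A)$ is a conflation, $x$ is an inflation, $y$ is a deflation, and the sequence together with $\delta$ is an $\mathbb{E}$-triangle, written $A\to B\to C\dashrightarrow$. **Exactness.** A morphism $f$ is compatible if "$f$ is both an inflation and a deflation" implies that $f$ is an isomorphism. A sequence $A\xrightarrow{f}B\xrightarrow{g}C$ is right exact if there are an $\mathbb{E}$-triangle $K\xrightarrow{h_2}B\xrightarrow{g}C\dashrightarrow$ and a compatible deflation $h_1\colon A\to K$ with $f=h_2h_1$; dually it is left exact if there are an $\mathbb{E}$-triangle $A\xrightarrow{f}B\xrightarrow{h_1}K\dashrightarrow$ and a compatible inflation $h_2\colon K\to C$ with $g=h_2h_1$.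 A 4-term $\mathbb{E}$-triangle sequence $A\xrightarrow{f}B\xrightarrow{g}C\xrightarrow{h}D$ is right exact (resp. left exact) if there are $\mathbb{E}$-triangles $A\xrightarrow{f}B\xrightarrow{g_1}K\dashrightarrow$ and $K\xrightarrow{g_2}C\xrightarrow{h}D\dashrightarrow$ with $g=g_2g_1$ and $g_1$ (resp. $g_2$) compatible. An additive functor $F\colon\mathcal{A}\to\mathcal{B}$ between extriangulated categories is right exact if (1) $F$ preserves compatible morphisms; (2) $F$ preserves right exact sequences (so for every $\mathbb{E}_{\mathcal A}$-triangle $A\xrightarrow{f}B\xrightarrow{g}C\overset{\delta}{\dashrightarrow}$ there is an $\mathbb{E}_{\mathcal B}$-triangle $A'\xrightarrow{x}FB\xrightarrow{Fg}FC\dashrightarrow$ with $Ff=xy$ for a compatible deflation $y\colon FA\to A'$, where $A'$ is unique up to isomorphism); (3) there is a natural transformation $\eta_{(C,A)}\colon\mathbb{E}_{\mathcal A}(C,A)\to\mathbb{E}_{\mathcal B}(FC,A')$ with $\mathfrak{s}_{\mathcal B}(\eta_{(C,A)}(\delta))=[A'\xrightarrow{x}FB\xrightarrow{Fg}FC]$. Left exact functors are defined dually. $F$ is exact if it preserves compatible morphisms and there is a natural transformation $\eta\colon\mathbb{E}_{\mathcal A}(-,-)\Rightarrow\mathbb{E}_{\mathcal B}(F-,F-)$ such that $\mathfrak{s}_{\mathcal A}(\delta)=[A\xrightarrow{x}B\xrightarrow{y}C]$ implies $\mathfrak{s}_{\mathcal B}(\eta(\delta))=[FA\xrightarrow{Fx}FB\xrightarrow{Fy}FC]$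 (equivalently, $F$ is both left and right exact). **Recollement.** A recollement $(\mathcal{A},\mathcal{B},\mathcal{C})$ of extriangulated categories consists of two exact functors $i_*\colon\mathcal{A}\to\mathcal{B}$, $j^*\colon\mathcal{B}\to\mathcal{C}$, two right exact functors $i^*\colon\mathcal{B}\to\mathcal{A}$, $j_!\colon\mathcal{C}\to\mathcal{B}$, and two left exact functors $i^!\colon\mathcal{B}\to\mathcal{A}$, $j_*\colon\mathcal{C}\to\mathcal{B}$ such that: (R1) $(i^*,i_*,i^!)$ and $(j_!,j^*,j_* )$ are adjoint triples; (R2) $\operatorname{Im} i_*=\operatorname{Ker} j^*$ (essential image; objects killed by $j^*$); (R3) $i_*,j_!,j_*$ are fully faithful; (R4) for each $X\in\mathcal{B}$ there is a left exact 4-term $\mathbb{E}_{\mathcal B}$-triangle sequence $i_*i^!X\to X\to j_*j^*X\to i_*A$ with $A\in\mathcal{A}$, the first two maps being the adjunction morphisms; (R5) for each $X\in\mathcal{B}$ there is a right exact 4-term $\mathbb{E}_{\mathcal B}$-triangle sequence $i_*A'\to j_!j^*X\to X\to i_*i^*X$ with $A'\in\mathcal{A}$, the last two maps being the adjunction morphisms. **Torsion pairs.** A pair $(\mathcal{T},\mathcal{F})$ of subcategories of an extriangulated category $\mathcal{C}$ is a torsion pair if (a) $\operatorname{Hom}_{\mathcal C}(T,F)=0$ for all $T\in\mathcal{T}$, $F\in\mathcal{F}$; (b) for every $C\in\mathcal{C}$ there is a conflation $T\to C\to F$ with $T\in\mathcal{T}$, $F\in\mathcal{F}$. Subcategories are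 full, closed under isomorphisms and contain the zero object. For a functor $G$ and a subcategory $\mathcal{X}$, $G\mathcal{X}$ denotes the full subcategory of objects isomorphic to $GX$ for some $X\in\mathcal{X}$. *)

theory Defs
  imports "HOL-Algebra.Group"
begin

text \<open>
  A triple consisting of a preadditive category, a bifunctor to abelian groups and a realization.
  Every element of the type \<^typ>\<open>'o\<close> is an object; morphisms and extensions live in carrier sets.
  Abelian groups are those of HOL-Algebra and hence written multiplicatively: in a hom-group or
  an extension group, \<open>\<otimes>\<close> is the sum and \<open>\<one>\<close> is zero.

  \<open>ExtGrp S C A\<close> is the group of extensions of \<open>C\<close> by \<open>A\<close>, contravariant in \<open>C\<close> and covariant
  in \<open>A\<close>; \<open>ExtMap S c a\<close> is the action of the bifunctor on a pair of morphisms. \<open>Realize S C A \<delta>\<close>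
  is an equivalence class of sequences \<open>A \<rightarrow> B \<rightarrow> C\<close>, a sequence being stored as the triple
  \<open>(B, x, y)\<close> of its middle term and its two morphisms.
\<close>

record ('o, 'm, 'e) extcat =
  HomGrp :: "'o \<Rightarrow> 'o \<Rightarrow> 'm monoid"
  Comp :: "'m \<Rightarrow> 'm \<Rightarrow> 'm"  (infixl "\<cdot>\<index>" 75)
  Ident :: "'o \<Rightarrow> 'm"
  ExtGrp :: "'o \<Rightarrow> 'o \<Rightarrow> 'e monoid"
  ExtMap :: "'m \<Rightarrow> 'm \<Rightarrow> 'e \<Rightarrow> 'e"
  Realize :: "'o \<Rightarrow> 'o \<Rightarrow> 'e \<Rightarrow> ('o \<times> 'm \<times> 'm) set"

abbreviation mor :: "('o, 'm, 'e) extcat \<Rightarrow> 'o \<Rightarrow> 'o \<Rightarrow> 'm set" where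
  "mor S X Y \<equiv> carrier (HomGrp S X Y)"

abbreviation Ext :: "('o, 'm, 'e) extcat \<Rightarrow> 'o \<Rightarrow> 'o \<Rightarrow> 'e set" where
  "Ext S C A \<equiv> carrier (ExtGrp S C A)"

text \<open>The dual of a notion for \<open>S\<close> is the notion for \<open>opp S\<close>.\<close>

definition opp :: "('o, 'm, 'e) extcat \<Rightarrow> ('o, 'm, 'e) extcat" where
  "opp S = \<lparr> HomGrp = (\<lambda>X Y. HomGrp S Y X), Comp = (\<lambda>g f. f \<cdot>\<^bsub>S\<^esub> g), Ident = Ident S,
     ExtGrp = (\<lambda>C A. ExtGrp S A C), ExtMap = (\<lambda>c a. ExtMap S a c),
     Realize = (\<lambda>C A d. {(B, y, x). (B, x, y) \<in> Realize S A C d}) \<rparr>"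


section \<open>Additive categories\<close>

definition isomorphism :: "('o, 'm, 'e) extcat \<Rightarrow> 'm \<Rightarrow> bool" where
  "isomorphism S f \<longleftrightarrow> (\<exists>X Y g. f \<in> mor S X Y \<and> g \<in> mor S Y X \<and>
     g \<cdot>\<^bsub>S\<^esub> f = Ident S X \<and> f \<cdot>\<^bsub>S\<^esub> g = Ident S Y)"

definition iso_obj :: "('o, 'm, 'e) extcat \<Rightarrow> 'o \<Rightarrow> 'o \<Rightarrow> bool" where
  "iso_obj S X Y \<longleftrightarrow> (\<exists>f \<in> mor S X Y. isomorphism S f)"

definition zero_obj :: "('o, 'm, 'e) extcat \<Rightarrow> 'o \<Rightarrow> bool" where
  "zero_obj S Z \<longleftrightarrow> (\<forall>X. \<exists>!f. f \<in> mor S X Z) \<and> (\<forall>X. \<exists>!f. f \<in> mor S Z X)"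

definition biproduct ::
  "('o, 'm, 'e) extcat \<Rightarrow> 'o \<Rightarrow> 'o \<Rightarrow> 'o \<Rightarrow> 'm \<Rightarrow> 'm \<Rightarrow> 'm \<Rightarrow> 'm \<Rightarrow> bool" where
  "biproduct S X Y P i1 i2 p1 p2 \<longleftrightarrow>
     i1 \<in> mor S X P \<and> i2 \<in> mor S Y P \<and> p1 \<in> mor S P X \<and> p2 \<in> mor S P Y \<and>
     p1 \<cdot>\<^bsub>S\<^esub> i1 = Ident S X \<and> p2 \<cdot>\<^bsub>S\<^esub> i2 = Ident S Y \<and>
     p1 \<cdot>\<^bsub>S\<^esub> i2 = \<one>\<^bsub>HomGrp S Y X\<^esub> \<and> p2 \<cdot>\<^bsub>S\<^esub> i1 = \<one>\<^bsub>HomGrp S X Y\<^esub> \<and>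
     (i1 \<cdot>\<^bsub>S\<^esub> p1) \<otimes>\<^bsub>HomGrp S P P\<^esub> (i2 \<cdot>\<^bsub>S\<^esub> p2) = Ident S P"

locale additive_category =
  fixes S :: "('o, 'm, 'e) extcat" (structure)
  assumes Hom_comm_group: "comm_group (HomGrp S X Y)"
    and Hom_disjoint: "\<lbrakk>f \<in> mor S X Y; f \<in> mor S X' Y'\<rbrakk> \<Longrightarrow> X = X' \<and> Y = Y'"
    and Ident_mor: "Ident S X \<in> mor S X X"
    and Ident_left: "f \<in> mor S X Y \<Longrightarrow> Ident S Y \<cdot> f = f"
    and Ident_right: "f \<in> mor S X Y \<Longrightarrow> f \<cdot> Ident S X = f"
    and Comp_assoc: "\<lbrakk>f \<in> mor S W X; g \<in> mor S X Y; h \<in> mor S Y Z\<rbrakk> \<Longrightarrow> (h \<cdot> g) \<cdot> f = h \<cdot> (g \<cdot> f)"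
    and Comp_hom_right: "g \<in> mor S Y Z \<Longrightarrow> (\<lambda>f. g \<cdot> f) \<in> hom (HomGrp S X Y) (HomGrp S X Z)"
    and Comp_hom_left: "f \<in> mor S X Y \<Longrightarrow> (\<lambda>g. g \<cdot> f) \<in> hom (HomGrp S Y Z) (HomGrp S X Z)"
    and zero_exists: "\<exists>Z. zero_obj S Z"
    and biproduct_exists: "\<exists>P i1 i2 p1 p2. biproduct S X Y P i1 i2 p1 p2"


section \<open>Extriangulated categories\<close>

locale additive_bifunctor = additive_category +
  assumes Ext_comm_group: "comm_group (ExtGrp S C A)"
    and ExtMap_hom: "\<lbrakk>c \<in> mor S C' C; a \<in> mor S A A'\<rbrakk> \<Longrightarrow>
      ExtMap S c a \<in> hom (ExtGrp S C A) (ExtGrp S C' A')"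
    and ExtMap_Ident: "d \<in> Ext S C A \<Longrightarrow> ExtMap S (Ident S C) (Ident S A) d = d"
    and ExtMap_Comp: "\<lbrakk>c \<in> mor S C' C; c' \<in> mor S C'' C'; a \<in> mor S A A'; a' \<in> mor S A' A'';
      d \<in> Ext S C A\<rbrakk> \<Longrightarrow> ExtMap S (c \<cdot> c') (a' \<cdot> a) d = ExtMap S c' a' (ExtMap S c a d)"
    and ExtMap_add_left: "\<lbrakk>c \<in> mor S C' C; c' \<in> mor S C' C; a \<in> mor S A A'; d \<in> Ext S C A\<rbrakk> \<Longrightarrow>
      ExtMap S (c \<otimes>\<^bsub>HomGrp S C' C\<^esub> c') a d = ExtMap S c a d \<otimes>\<^bsub>ExtGrp S C' A'\<^esub> ExtMap S c' a d"
    and ExtMap_add_right: "\<lbrakk>c \<in> mor S C' C; a \<in> mor S A A'; a' \<in> mor S A A'; d \<in> Ext S C A\<rbrakk> \<Longrightarrow>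
      ExtMap S c (a \<otimes>\<^bsub>HomGrp S A A'\<^esub> a') d = ExtMap S c a d \<otimes>\<^bsub>ExtGrp S C' A'\<^esub> ExtMap S c a' d"

text \<open>
  For \<open>d \<in> Ext S C A\<close>, the extensions \<open>a\<^sub>*d\<close> and \<open>c\<^sup>*d\<close> are \<open>push S C a d\<close> and \<open>pull S A c d\<close>. The end
  term held fixed is an explicit argument, since the extension groups need not be disjoint.
\<close>

definition push :: "('o, 'm, 'e) extcat \<Rightarrow> 'o \<Rightarrow> 'm \<Rightarrow> 'e \<Rightarrow> 'e" where
  "push S C a d = ExtMap S (Ident S C) a d"

definition pull :: "('o, 'm, 'e) extcat \<Rightarrow> 'o \<Rightarrow> 'm \<Rightarrow> 'e \<Rightarrow> 'e" where
  "pull S A c d = ExtMap S c (Ident S A) d"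

definition ext_morphism ::
  "('o, 'm, 'e) extcat \<Rightarrow> 'o \<Rightarrow> 'o \<Rightarrow> 'e \<Rightarrow> 'o \<Rightarrow> 'o \<Rightarrow> 'e \<Rightarrow> 'm \<Rightarrow> 'm \<Rightarrow> bool" where
  "ext_morphism S C A d C' A' d' a c \<longleftrightarrow>
     d \<in> Ext S C A \<and> d' \<in> Ext S C' A' \<and> a \<in> mor S A A' \<and> c \<in> mor S C C' \<and>
     push S C a d = pull S A' c d'"

definition seqs :: "('o, 'm, 'e) extcat \<Rightarrow> 'o \<Rightarrow> 'o \<Rightarrow> ('o \<times> 'm \<times> 'm) set" where
  "seqs S A C = {(B, x, y). x \<in> mor S A B \<and> y \<in> mor S B C}"

definition seq_equiv ::
  "('o, 'm, 'e) extcat \<Rightarrow> 'o \<Rightarrow> 'o \<Rightarrow> (('o \<times> 'm \<times> 'm) \<times> ('o \<times> 'm \<times> 'm)) set" where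
  "seq_equiv S A C = {((B, x, y), (B', x', y')).
     (B, x, y) \<in> seqs S A C \<and> (B', x', y') \<in> seqs S A C \<and>
     (\<exists>b \<in> mor S B B'. isomorphism S b \<and> b \<cdot>\<^bsub>S\<^esub> x = x' \<and> y' \<cdot>\<^bsub>S\<^esub> b = y)}"

text \<open>Since \<open>Realize S C A d\<close> is an equivalence class, membership in it says that it is the class of
  the given sequence.\<close>

definition etriangle ::
  "('o, 'm, 'e) extcat \<Rightarrow> 'o \<Rightarrow> 'o \<Rightarrow> 'o \<Rightarrow> 'm \<Rightarrow> 'm \<Rightarrow> 'e \<Rightarrow> bool" where
  "etriangle S A B C x y d \<longleftrightarrow> d \<in> Ext S C A \<and> (B, x, y) \<in> Realize S C A d"

definition conflation :: "('o, 'm, 'e) extcat \<Rightarrow> 'o \<Rightarrow> 'o \<Rightarrow> 'o \<Rightarrow> 'm \<Rightarrow> 'm \<Rightarrow> bool" where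
  "conflation S A B C x y \<longleftrightarrow> (\<exists>d. etriangle S A B C x y d)"

definition inflation :: "('o, 'm, 'e) extcat \<Rightarrow> 'm \<Rightarrow> bool" where
  "inflation S x \<longleftrightarrow> (\<exists>A B C y. conflation S A B C x y)"

definition deflation :: "('o, 'm, 'e) extcat \<Rightarrow> 'm \<Rightarrow> bool" where
  "deflation S y \<longleftrightarrow> (\<exists>A B C x. conflation S A B C x y)"

text \<open>In \<open>Real_sum\<close>, the extension \<open>d \<oplus> d'\<close> is \<open>i\<^sub>1\<^sub>*p\<^sub>1\<^sup>*d + i\<^sub>2\<^sub>*p\<^sub>2\<^sup>*d'\<close>, and a morphism \<open>x \<oplus> x'\<close> is
  \<open>i\<^sub>1xp\<^sub>1 + i\<^sub>2x'p\<^sub>2\<close>.\<close>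

locale additive_realization = additive_bifunctor +
  assumes Real_class: "d \<in> Ext S C A \<Longrightarrow> Realize S C A d \<in> seqs S A C // seq_equiv S A C"
    and Real_morphism: "\<lbrakk>ext_morphism S C A d C' A' d' a c;
      etriangle S A B C x y d; etriangle S A' B' C' x' y' d'\<rbrakk> \<Longrightarrow>
      \<exists>b \<in> mor S B B'. b \<cdot> x = x' \<cdot> a \<and> y' \<cdot> b = c \<cdot> y"
    and Real_zero: "biproduct S A C P iA iC pA pC \<Longrightarrow> (P, iA, pC) \<in> Realize S C A \<one>\<^bsub>ExtGrp S C A\<^esub>"
    and Real_sum: "\<lbrakk>etriangle S A B C x y d; etriangle S A' B' C' x' y' d';
      biproduct S A A' PA iA iA' pA pA'; biproduct S B B' PB iB iB' pB pB';
      biproduct S C C' PC iC iC' pC pC'\<rbrakk> \<Longrightarrow>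
      (PB, (iB \<cdot> x \<cdot> pA) \<otimes>\<^bsub>HomGrp S PA PB\<^esub> (iB' \<cdot> x' \<cdot> pA'),
           (iC \<cdot> y \<cdot> pB) \<otimes>\<^bsub>HomGrp S PB PC\<^esub> (iC' \<cdot> y' \<cdot> pB'))
      \<in> Realize S PC PA (ExtMap S pC iA d \<otimes>\<^bsub>ExtGrp S PC PA\<^esub> ExtMap S pC' iA' d')"

definition ET3 :: "('o, 'm, 'e) extcat \<Rightarrow> bool" where
  "ET3 S \<longleftrightarrow> (\<forall>A B C x y d A' B' C' x' y' d' a b.
     etriangle S A B C x y d \<and> etriangle S A' B' C' x' y' d' \<and>
     a \<in> mor S A A' \<and> b \<in> mor S B B' \<and> b \<cdot>\<^bsub>S\<^esub> x = x' \<cdot>\<^bsub>S\<^esub> a \<longrightarrow>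
     (\<exists>c \<in> mor S C C'. c \<cdot>\<^bsub>S\<^esub> y = y' \<cdot>\<^bsub>S\<^esub> b \<and> push S C a d = pull S A' c d'))"

definition ET4 :: "('o, 'm, 'e) extcat \<Rightarrow> bool" where
  "ET4 S \<longleftrightarrow> (\<forall>A B C D F f f' g g' \<delta> \<delta>'.
     etriangle S A B D f f' \<delta> \<and> etriangle S B C F g g' \<delta>' \<longrightarrow>
     (\<exists>E h' d e \<delta>''. h' \<in> mor S C E \<and> d \<in> mor S D E \<and> e \<in> mor S E F \<and>
        etriangle S A C E (g \<cdot>\<^bsub>S\<^esub> f) h' \<delta>'' \<and>
        d \<cdot>\<^bsub>S\<^esub> f' = h' \<cdot>\<^bsub>S\<^esub> g \<and> e \<cdot>\<^bsub>S\<^esub> h' = g' \<and>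
        etriangle S D E F d e (push S F f' \<delta>') \<and>
        pull S A d \<delta>'' = \<delta> \<and> push S E f \<delta>'' = pull S B e \<delta>'))"

locale extriangulated = additive_realization +
  assumes ET3: "ET3 S" and ET3_op: "ET3 (opp S)"
    and ET4: "ET4 S" and ET4_op: "ET4 (opp S)"


section \<open>Exact sequences and exact functors\<close>

definition compatible :: "('o, 'm, 'e) extcat \<Rightarrow> 'm \<Rightarrow> bool" where
  "compatible S f \<longleftrightarrow> (\<exists>X Y. f \<in> mor S X Y) \<and> (inflation S f \<and> deflation S f \<longrightarrow> isomorphism S f)"

definition right_exact_seq :: "('o, 'm, 'e) extcat \<Rightarrow> 'o \<Rightarrow> 'o \<Rightarrow> 'o \<Rightarrow> 'm \<Rightarrow> 'm \<Rightarrow> bool" where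
  "right_exact_seq S A B C f g \<longleftrightarrow> (\<exists>K h1 h2 d. etriangle S K B C h2 g d \<and>
     h1 \<in> mor S A K \<and> deflation S h1 \<and> compatible S h1 \<and> f = h2 \<cdot>\<^bsub>S\<^esub> h1)"

definition left_exact_seq :: "('o, 'm, 'e) extcat \<Rightarrow> 'o \<Rightarrow> 'o \<Rightarrow> 'o \<Rightarrow> 'm \<Rightarrow> 'm \<Rightarrow> bool" where
  "left_exact_seq S A B C f g \<longleftrightarrow> (\<exists>K h1 h2 d. etriangle S A B K f h1 d \<and>
     h2 \<in> mor S K C \<and> inflation S h2 \<and> compatible S h2 \<and> g = h2 \<cdot>\<^bsub>S\<^esub> h1)"

definition right_exact_seq4 ::
  "('o, 'm, 'e) extcat \<Rightarrow> 'o \<Rightarrow> 'o \<Rightarrow> 'o \<Rightarrow> 'o \<Rightarrow> 'm \<Rightarrow> 'm \<Rightarrow> 'm \<Rightarrow> bool" where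
  "right_exact_seq4 S A B C D f g h \<longleftrightarrow> (\<exists>K g1 g2 d d'. etriangle S A B K f g1 d \<and>
     etriangle S K C D g2 h d' \<and> g = g2 \<cdot>\<^bsub>S\<^esub> g1 \<and> compatible S g1)"

definition left_exact_seq4 ::
  "('o, 'm, 'e) extcat \<Rightarrow> 'o \<Rightarrow> 'o \<Rightarrow> 'o \<Rightarrow> 'o \<Rightarrow> 'm \<Rightarrow> 'm \<Rightarrow> 'm \<Rightarrow> bool" where
  "left_exact_seq4 S A B C D f g h \<longleftrightarrow> (\<exists>K g1 g2 d d'. etriangle S A B K f g1 d \<and>
     etriangle S K C D g2 h d' \<and> g = g2 \<cdot>\<^bsub>S\<^esub> g1 \<and> compatible S g2)"

record ('o1, 'm1, 'o2, 'm2) cfunctor =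
  FO :: "'o1 \<Rightarrow> 'o2"
  FM :: "'m1 \<Rightarrow> 'm2"

locale additive_functor =
  fixes S :: "('o1, 'm1, 'e1) extcat" and T :: "('o2, 'm2, 'e2) extcat"
    and F :: "('o1, 'm1, 'o2, 'm2) cfunctor"
  assumes FM_hom: "FM F \<in> hom (HomGrp S X Y) (HomGrp T (FO F X) (FO F Y))"
    and FM_Ident: "FM F (Ident S X) = Ident T (FO F X)"
    and FM_Comp: "\<lbrakk>f \<in> mor S X Y; g \<in> mor S Y Z\<rbrakk> \<Longrightarrow> FM F (g \<cdot>\<^bsub>S\<^esub> f) = FM F g \<cdot>\<^bsub>T\<^esub> FM F f"

text \<open>
  Let \<open>F\<close> be right exact and \<open>d \<in> Ext S C A\<close> be realized by \<open>A \<rightarrow> B \<rightarrow> C\<close>. The object \<open>A'\<close> in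
  \<open>A' \<rightarrow> F B \<rightarrow> F C\<close> depends on \<open>d\<close> and not only on \<open>(C, A)\<close>: for a right exact functor of abelian
  categories it is the image of \<open>F A \<rightarrow> F B\<close>. So \<open>A'\<close>, the compatible deflation \<open>y\<close> from \<open>F A\<close> to
  \<open>A'\<close> and the extension \<open>\<eta>\<close> are families indexed by \<open>C\<close>, \<open>A\<close> and \<open>d\<close>. Naturality of \<open>\<eta>\<close> means that
  every morphism of extensions \<open>(a, c)\<close> from \<open>d\<close> to \<open>e\<close> yields one of the form \<open>(a', F c)\<close> from
  \<open>\<eta> d\<close> to \<open>\<eta> e\<close>, where \<open>a'\<close> is a morphism between the objects \<open>A'\<close> induced by \<open>F a\<close> along \<open>y\<close>.
\<close>

definition right_exact_functor ::
  "('o1, 'm1, 'e1) extcat \<Rightarrow> ('o2, 'm2, 'e2) extcat \<Rightarrow> ('o1, 'm1, 'o2, 'm2) cfunctor \<Rightarrow> bool" where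
  "right_exact_functor S T F \<longleftrightarrow> additive_functor S T F \<and>
     (\<forall>f. compatible S f \<longrightarrow> compatible T (FM F f)) \<and>
     (\<forall>A B C f g. right_exact_seq S A B C f g \<longrightarrow>
        right_exact_seq T (FO F A) (FO F B) (FO F C) (FM F f) (FM F g)) \<and>
     (\<exists>A' y \<eta>.
        (\<forall>C A. \<forall>d \<in> Ext S C A. y C A d \<in> mor T (FO F A) (A' C A d) \<and>
           deflation T (y C A d) \<and> compatible T (y C A d) \<and>
           \<eta> C A d \<in> Ext T (FO F C) (A' C A d)) \<and>
        (\<forall>A B C f g d. etriangle S A B C f g d \<longrightarrow>
           (\<exists>x. FM F f = x \<cdot>\<^bsub>T\<^esub> y C A d \<and>
              etriangle T (A' C A d) (FO F B) (FO F C) x (FM F g) (\<eta> C A d))) \<and>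
        (\<forall>C A d D B e a c. ext_morphism S C A d D B e a c \<longrightarrow>
           (\<exists>a'. a' \<cdot>\<^bsub>T\<^esub> y C A d = y D B e \<cdot>\<^bsub>T\<^esub> FM F a \<and>
              ext_morphism T (FO F C) (A' C A d) (\<eta> C A d) (FO F D) (A' D B e) (\<eta> D B e)
                a' (FM F c))))"

definition left_exact_functor ::
  "('o1, 'm1, 'e1) extcat \<Rightarrow> ('o2, 'm2, 'e2) extcat \<Rightarrow> ('o1, 'm1, 'o2, 'm2) cfunctor \<Rightarrow> bool" where
  "left_exact_functor S T F \<longleftrightarrow> right_exact_functor (opp S) (opp T) F"

lemma opp_simps [simp]:
  "HomGrp (opp S) X Y = HomGrp S Y X" "g \<cdot>\<^bsub>opp S\<^esub> f = f \<cdot>\<^bsub>S\<^esub> g" "Ident (opp S) = Ident S"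
  "ExtGrp (opp S) C A = ExtGrp S A C" "ExtMap (opp S) c a = ExtMap S a c"
  "(B, y, x) \<in> Realize (opp S) C A d \<longleftrightarrow> (B, x, y) \<in> Realize S A C d"
  by (simp_all add: opp_def)

lemma etriangle_opp [simp]: "etriangle (opp S) C B A y x d \<longleftrightarrow> etriangle S A B C x y d"
  by (simp add: etriangle_def)

text \<open>So \<open>left_exact_functor\<close> is about the left exact sequences defined above.\<close>

lemma right_exact_seq_opp: "right_exact_seq (opp S) C B A g f \<longleftrightarrow> left_exact_seq S A B C f g"
proof -
  have infl: "inflation (opp S) h \<longleftrightarrow> deflation S h" for h
    unfolding inflation_def deflation_def conflation_def by (metis etriangle_opp)
  have defl: "deflation (opp S) h \<longleftrightarrow> inflation S h" for h
    unfolding inflation_def deflation_def conflation_def by (metis etriangle_opp)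
  have "isomorphism (opp S) h \<longleftrightarrow> isomorphism S h" for h
    unfolding isomorphism_def by simp blast
  then have "compatible (opp S) h \<longleftrightarrow> compatible S h" for h
    unfolding compatible_def infl defl by simp blast
  then show ?thesis
    unfolding right_exact_seq_def left_exact_seq_def by (simp add: defl) blast
qed

definition exact_functor ::
  "('o1, 'm1, 'e1) extcat \<Rightarrow> ('o2, 'm2, 'e2) extcat \<Rightarrow> ('o1, 'm1, 'o2, 'm2) cfunctor \<Rightarrow> bool" where
  "exact_functor S T F \<longleftrightarrow> additive_functor S T F \<and>
     (\<forall>f. compatible S f \<longrightarrow> compatible T (FM F f)) \<and>
     (\<exists>\<eta>. (\<forall>C A. \<eta> C A \<in> hom (ExtGrp S C A) (ExtGrp T (FO F C) (FO F A))) \<and>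
        (\<forall>C C' A A'. \<forall>c \<in> mor S C' C. \<forall>a \<in> mor S A A'. \<forall>d \<in> Ext S C A.
           \<eta> C' A' (ExtMap S c a d) = ExtMap T (FM F c) (FM F a) (\<eta> C A d)) \<and>
        (\<forall>A B C x y d. etriangle S A B C x y d \<longrightarrow>
           etriangle T (FO F A) (FO F B) (FO F C) (FM F x) (FM F y) (\<eta> C A d)))"


section \<open>Recollements\<close>

locale adjunction =
  fixes S :: "('o1, 'm1, 'e1) extcat" and T :: "('o2, 'm2, 'e2) extcat"
    and L :: "('o1, 'm1, 'o2, 'm2) cfunctor" and R :: "('o2, 'm2, 'o1, 'm1) cfunctor"
    and un :: "'o1 \<Rightarrow> 'm1" and co :: "'o2 \<Rightarrow> 'm2"
  assumes un_mor: "un X \<in> mor S X (FO R (FO L X))"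
    and un_natural: "f \<in> mor S X X' \<Longrightarrow> un X' \<cdot>\<^bsub>S\<^esub> f = FM R (FM L f) \<cdot>\<^bsub>S\<^esub> un X"
    and co_mor: "co Y \<in> mor T (FO L (FO R Y)) Y"
    and co_natural: "g \<in> mor T Y Y' \<Longrightarrow> g \<cdot>\<^bsub>T\<^esub> co Y = co Y' \<cdot>\<^bsub>T\<^esub> FM L (FM R g)"
    and triangle_left: "co (FO L X) \<cdot>\<^bsub>T\<^esub> FM L (un X) = Ident T (FO L X)"
    and triangle_right: "FM R (co Y) \<cdot>\<^bsub>S\<^esub> un (FO R Y) = Ident S (FO R Y)"

definition fully_faithful ::
  "('o1, 'm1, 'e1) extcat \<Rightarrow> ('o2, 'm2, 'e2) extcat \<Rightarrow> ('o1, 'm1, 'o2, 'm2) cfunctor \<Rightarrow> bool" where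
  "fully_faithful S T F \<longleftrightarrow> (\<forall>X Y. bij_betw (FM F) (mor S X Y) (mor T (FO F X) (FO F Y)))"

definition ess_image ::
  "('o2, 'm2, 'e2) extcat \<Rightarrow> ('o1, 'm1, 'o2, 'm2) cfunctor \<Rightarrow> 'o1 set \<Rightarrow> 'o2 set" where
  "ess_image T F U = {Y. \<exists>X \<in> U. iso_obj T Y (FO F X)}"

definition kernel_objs ::
  "('o2, 'm2, 'e2) extcat \<Rightarrow> ('o1, 'm1, 'o2, 'm2) cfunctor \<Rightarrow> 'o1 set" where
  "kernel_objs T F = {X. zero_obj T (FO F X)}"

text \<open>
  The functors \<open>iL\<close>, \<open>i\<close>, \<open>iR\<close>, \<open>jL\<close>, \<open>j\<close>, \<open>jR\<close> are \<open>i\<^sup>*\<close>, \<open>i\<^sub>*\<close>, \<open>i\<^sup>!\<close>, \<open>j\<^sub>!\<close>, \<open>j\<^sup>*\<close>, \<open>j\<^sub>*\<close> respectively: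
  \<open>L\<close> and \<open>R\<close> mark left and right adjoints.
\<close>

definition recollement ::
  "('oa, 'ma, 'ea) extcat \<Rightarrow> ('ob, 'mb, 'eb) extcat \<Rightarrow> ('oc, 'mc, 'ec) extcat \<Rightarrow>
   ('ob, 'mb, 'oa, 'ma) cfunctor \<Rightarrow> ('oa, 'ma, 'ob, 'mb) cfunctor \<Rightarrow> ('ob, 'mb, 'oa, 'ma) cfunctor \<Rightarrow>
   ('oc, 'mc, 'ob, 'mb) cfunctor \<Rightarrow> ('ob, 'mb, 'oc, 'mc) cfunctor \<Rightarrow> ('oc, 'mc, 'ob, 'mb) cfunctor \<Rightarrow>
   bool" where
  "recollement \<A> \<B> \<C> iL i iR jL j jR \<longleftrightarrow>
     exact_functor \<A> \<B> i \<and> exact_functor \<B> \<C> j \<and>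
     right_exact_functor \<B> \<A> iL \<and> right_exact_functor \<C> \<B> jL \<and>
     left_exact_functor \<B> \<A> iR \<and> left_exact_functor \<C> \<B> jR \<and>
     ess_image \<B> i UNIV = kernel_objs \<C> j \<and>
     fully_faithful \<A> \<B> i \<and> fully_faithful \<C> \<B> jL \<and> fully_faithful \<C> \<B> jR \<and>
     (\<exists>un_iL co_iL un_iR co_iR un_jL co_jL un_jR co_jR.
        adjunction \<B> \<A> iL i un_iL co_iL \<and> adjunction \<A> \<B> i iR un_iR co_iR \<and>
        adjunction \<C> \<B> jL j un_jL co_jL \<and> adjunction \<B> \<C> j jR un_jR co_jR \<and>
        (\<forall>X. \<exists>A h. left_exact_seq4 \<B> (FO i (FO iR X)) X (FO jR (FO j X)) (FO i A)
                (co_iR X) (un_jR X) h) \<and>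
        (\<forall>X. \<exists>A' h. right_exact_seq4 \<B> (FO i A') (FO jL (FO j X)) X (FO i (FO iL X))
                h (co_jL X) (un_iL X)))"


section \<open>Torsion pairs\<close>

text \<open>Full subcategories are given by their sets of objects.\<close>

definition subcategory :: "('o, 'm, 'e) extcat \<Rightarrow> 'o set \<Rightarrow> bool" where
  "subcategory S U \<longleftrightarrow> (\<forall>X Y. X \<in> U \<and> iso_obj S X Y \<longrightarrow> Y \<in> U) \<and> (\<forall>Z. zero_obj S Z \<longrightarrow> Z \<in> U)"

definition torsion_pair :: "('o, 'm, 'e) extcat \<Rightarrow> 'o set \<Rightarrow> 'o set \<Rightarrow> bool" where
  "torsion_pair S \<T> \<F> \<longleftrightarrow> subcategory S \<T> \<and> subcategory S \<F> \<and>
     (\<forall>T \<in> \<T>. \<forall>F \<in> \<F>. mor S T F = {\<one>\<^bsub>HomGrp S T F\<^esub>}) \<and>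
     (\<forall>X. \<exists>T \<in> \<T>. \<exists>F \<in> \<F>. \<exists>x y. conflation S T X F x y)"

end

theory Submission
  imports Defs
begin

text \<open>
  In the second part, explicit preimages exist: \<open>X \<in> \<T>\<^sub>1\<close> is isomorphic to
  \<open>iL i X\<close>, and \<open>i X \<in> \<T>\<close> because \<open>j i = 0\<close>; \<open>X \<in> \<T>\<^sub>2\<close> is isomorphic to \<open>j jL X\<close>, and \<open>jL X \<in> \<T>\<close> because
  \<open>iL jL = 0\<close>. Dually, \<open>i X \<in> \<F>\<close> for \<open>X \<in> \<F>\<^sub>1\<close>, and \<open>jR X \<in> \<F>\<close> for \<open>X \<in> \<F>\<^sub>2\<close>, because \<open>iR jR = 0\<close>.

  The first part follows the gluing of t-structures by Beilinson, Bernstein and Deligne. Exactness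
  of \<open>iR\<close> forces the last term of the left exact sequence \<open>i iR X \<rightarrow> X \<rightarrow> jR j X \<rightarrow> i A\<close> to vanish
  (\<open>iR_exact_imp_triangle\<close>), so that the first three terms behave like a triangle. A morphism
  from \<open>\<T>\<close> to \<open>\<F>\<close> is therefore controlled by its components on the two sides of the recollement,
  which vanish (\<open>glued_Hom_zero\<close>). To decompose \<open>X\<close>, first the part of \<open>X\<close> coming from \<open>\<F>\<^sub>2\<close>
  and then the part coming from \<open>\<F>\<^sub>1\<close> is split off by taking cocones of deflations, and the fourth
  axiom assembles the two parts (\<open>glued_conflation\<close>).

  In an extriangulated category inflations need not be monic, and the left exact functor \<open>jR\<close> turns
  an inflation into one whose cone is not specified. What makes the argument work is that cones and
  cocones are unique up to isomorphism (\<open>cone_iso\<close>, \<open>cocone_iso\<close>). Half of the facts about triangles are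
  obtained from the other half by passing to the opposite category, which is again extriangulated.
\<close>

section \<open>Additive categories and their duals\<close>

abbreviation zero_mor :: "('o, 'm, 'e) extcat \<Rightarrow> 'o \<Rightarrow> 'o \<Rightarrow> 'm" where
  "zero_mor S X Y \<equiv> \<one>\<^bsub>HomGrp S X Y\<^esub>"

text \<open>Unlike \<^const>\<open>isomorphism\<close> and \<^const>\<open>iso_obj\<close>, this keeps track of source, target and inverse.\<close>

definition inverse_mors :: "('o, 'm, 'e) extcat \<Rightarrow> 'o \<Rightarrow> 'o \<Rightarrow> 'm \<Rightarrow> 'm \<Rightarrow> bool" where
  "inverse_mors S X Y f g \<longleftrightarrow> f \<in> mor S X Y \<and> g \<in> mor S Y X \<and>
     g \<cdot>\<^bsub>S\<^esub> f = Ident S X \<and> f \<cdot>\<^bsub>S\<^esub> g = Ident S Y"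

lemma inverse_mors_sym: "inverse_mors S X Y f g \<Longrightarrow> inverse_mors S Y X g f"
  by (auto simp: inverse_mors_def)

lemma isomorphism_iff_inverse_mors: "isomorphism S f \<longleftrightarrow> (\<exists>X Y g. inverse_mors S X Y f g)"
  by (simp add: isomorphism_def inverse_mors_def)

lemma opp_opp [simp]: "opp (opp S) = S"
  by (cases S) (simp add: opp_def)

lemma inverse_mors_opp [simp]: "inverse_mors (opp S) X Y f g \<longleftrightarrow> inverse_mors S Y X f g"
  by (auto simp: inverse_mors_def)

lemma isomorphism_opp [simp]: "isomorphism (opp S) f \<longleftrightarrow> isomorphism S f"
  by (auto simp: isomorphism_iff_inverse_mors)

lemma zero_obj_opp [simp]: "zero_obj (opp S) Z \<longleftrightarrow> zero_obj S Z"
  by (auto simp: zero_obj_def)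

lemma biproduct_opp [simp]:
  "biproduct (opp S) X Y P i1 i2 p1 p2 \<longleftrightarrow> biproduct S X Y P p1 p2 i1 i2"
  by (auto simp: biproduct_def)

lemma conflation_opp [simp]: "conflation (opp S) C B A y x \<longleftrightarrow> conflation S A B C x y"
  by (simp add: conflation_def)

context additive_category
begin

lemma Hom_group: "group (HomGrp S X Y)"
  using Hom_comm_group[of X Y] by (rule comm_group.axioms(2))

lemma zero_mor_in [simp, intro]: "zero_mor S X Y \<in> mor S X Y"
  using group.is_monoid[OF Hom_group] by (rule monoid.one_closed)

lemma Ident_in [simp, intro]: "Ident S X \<in> mor S X X"
  by (rule Ident_mor)

lemma Comp_in [simp, intro]: "f \<in> mor S X Y \<Longrightarrow> g \<in> mor S Y Z \<Longrightarrow> g \<cdot> f \<in> mor S X Z"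
  using Comp_hom_right[of g Y Z X] by (auto simp: hom_def)

lemma Comp_zero_right [simp]: "g \<in> mor S Y Z \<Longrightarrow> g \<cdot> zero_mor S X Y = zero_mor S X Z"
  using hom_one[OF Comp_hom_right[of g Y Z X] Hom_group Hom_group] by simp

lemma Comp_zero_left [simp]: "f \<in> mor S X Y \<Longrightarrow> zero_mor S Y Z \<cdot> f = zero_mor S X Z"
  using hom_one[OF Comp_hom_left[of f X Y Z] Hom_group Hom_group] by simp

lemma iso_obj_iff: "iso_obj S X Y \<longleftrightarrow> (\<exists>f g. inverse_mors S X Y f g)"
  unfolding iso_obj_def isomorphism_iff_inverse_mors inverse_mors_def using Hom_disjoint by metis

lemma iso_obj_sym: "iso_obj S X Y \<Longrightarrow> iso_obj S Y X"
  unfolding iso_obj_iff using inverse_mors_sym by metis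

lemma inverse_mors_Comp:
  assumes "inverse_mors S X Y f g" "inverse_mors S Y Z f' g'"
  shows "inverse_mors S X Z (f' \<cdot> f) (g \<cdot> g')"
proof -
  have m: "f \<in> mor S X Y" "g \<in> mor S Y X" "f' \<in> mor S Y Z" "g' \<in> mor S Z Y"
    and e: "g \<cdot> f = Ident S X" "f \<cdot> g = Ident S Y" "g' \<cdot> f' = Ident S Y" "f' \<cdot> g' = Ident S Z"
    using assms by (auto simp: inverse_mors_def)
  have "(g \<cdot> g') \<cdot> (f' \<cdot> f) = g \<cdot> ((g' \<cdot> f') \<cdot> f)"
    using Comp_assoc[OF m(1,3,4)] Comp_assoc[OF Comp_in[OF m(1,3)] m(4,2)] by simp
  moreover have "(f' \<cdot> f) \<cdot> (g \<cdot> g') = f' \<cdot> ((f \<cdot> g) \<cdot> g')"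
    using Comp_assoc[OF m(4,2,1)] Comp_assoc[OF Comp_in[OF m(4,2)] m(1,3)] by simp
  ultimately show ?thesis
    unfolding inverse_mors_def
    using e Comp_in[OF m(1,3)] Comp_in[OF m(4,2)] Ident_left[OF m(1)] Ident_left[OF m(4)] by simp
qed

lemma iso_obj_trans: "iso_obj S X Y \<Longrightarrow> iso_obj S Y Z \<Longrightarrow> iso_obj S X Z"
  unfolding iso_obj_iff using inverse_mors_Comp by metis

lemma inverse_mors_Ident: "inverse_mors S X X (Ident S X) (Ident S X)"
  by (simp add: inverse_mors_def Ident_left[of _ X X])

lemma zero_obj_iff: "zero_obj S Z \<longleftrightarrow> Ident S Z = zero_mor S Z Z"
proof
  assume "zero_obj S Z"
  then show "Ident S Z = zero_mor S Z Z"
    unfolding zero_obj_def by (metis Ident_in zero_mor_in)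
next
  assume e: "Ident S Z = zero_mor S Z Z"
  have "f = zero_mor S X Z" if "f \<in> mor S X Z" for f X
    using that Ident_left[OF that] e by simp
  moreover have "f = zero_mor S Z X" if "f \<in> mor S Z X" for f X
    using that Ident_right[OF that] e by simp
  ultimately show "zero_obj S Z"
    unfolding zero_obj_def by (metis zero_mor_in)
qed

lemma into_zero_obj: "zero_obj S Z \<Longrightarrow> f \<in> mor S X Z \<Longrightarrow> f = zero_mor S X Z"
  unfolding zero_obj_def by (metis zero_mor_in)

lemma from_zero_obj: "zero_obj S Z \<Longrightarrow> f \<in> mor S Z X \<Longrightarrow> f = zero_mor S Z X"
  unfolding zero_obj_def by (metis zero_mor_in)

lemma zero_obj_iso_obj: 
  assumes "zero_obj S X" "iso_obj S X Y"
  shows "zero_obj S Y"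
proof -
  obtain f g where fg: "inverse_mors S X Y f g" using assms(2) by (auto simp: iso_obj_iff)
  then have m: "f \<in> mor S X Y" "g \<in> mor S Y X" "f \<cdot> g = Ident S Y"
    by (auto simp: inverse_mors_def)
  have "f = zero_mor S X Y" using assms(1) m(1) by (rule from_zero_obj)
  then show ?thesis using m by (simp add: zero_obj_iff)
qed

lemma additive_category_opp: "additive_category (opp S)"
proof (rule additive_category.intro, unfold opp_simps, goal_cases)
  case (2 f X Y X' Y') then show ?case using Hom_disjoint by blast
next
  case 9 then show ?case using zero_exists by simp
next
  case 10 then show ?case using biproduct_exists unfolding biproduct_opp by blast
next
  case (7 g Y Z X) then show ?case using Comp_hom_left[of g Z Y X] by simp
next
  case (8 f X Y Z) then show ?case using Comp_hom_right[of f Y X Z] by simp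
qed (simp_all add: Hom_comm_group Ident_left Ident_right Comp_assoc)

lemma biproduct_swap:
  assumes "biproduct S X Y P i1 i2 p1 p2"
  shows "biproduct S Y X P i2 i1 p2 p1"
proof -
  have "i1 \<cdot> p1 \<in> mor S P P" "i2 \<cdot> p2 \<in> mor S P P"
    using assms unfolding biproduct_def by (meson Comp_in)+
  then have "(i2 \<cdot> p2) \<otimes>\<^bsub>HomGrp S P P\<^esub> (i1 \<cdot> p1) = (i1 \<cdot> p1) \<otimes>\<^bsub>HomGrp S P P\<^esub> (i2 \<cdot> p2)"
    by (simp add: comm_monoid.m_comm[OF comm_group.axioms(1)[OF Hom_comm_group]])
  then show ?thesis
    using assms unfolding biproduct_def by simp
qed

lemma biproduct_zero_iso:
  assumes Z: "zero_obj S Z" and fg: "inverse_mors S X Y f g"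
  shows "biproduct S Z Y X (zero_mor S Z X) g (zero_mor S X Z) f"
proof -
  have "g \<in> mor S Y X" "f \<in> mor S X Y" "f \<cdot> g = Ident S Y" "g \<cdot> f = Ident S X"
    using fg by (auto simp: inverse_mors_def)
  moreover have "Ident S Z = zero_mor S Z Z"
    using Z by (simp add: zero_obj_iff)
  ultimately show ?thesis
    unfolding biproduct_def
    using monoid.l_one[OF group.is_monoid[OF Hom_group] Ident_in, of X]
    by (simp add: Comp_zero_left[of _ X Z] Comp_zero_right[of _ _ _ Z] Comp_zero_left[of _ _ X])
qed

lemma unipotent_inverse_mors:
  assumes n: "n \<in> mor S X X" and nn: "n \<cdot> n = zero_mor S X X"
  shows "inverse_mors S X X (Ident S X \<otimes>\<^bsub>HomGrp S X X\<^esub> n)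
    (Ident S X \<otimes>\<^bsub>HomGrp S X X\<^esub> inv\<^bsub>HomGrp S X X\<^esub> n)"
proof -
  let ?G = "HomGrp S X X"
  interpret G: comm_group ?G by (rule Hom_comm_group)
  \<comment> \<open>Applied to \<open>n\<close> and to \<open>-n\<close>, this gives both composites.\<close>
  have *: "(Ident S X \<otimes>\<^bsub>?G\<^esub> a) \<cdot> (Ident S X \<otimes>\<^bsub>?G\<^esub> inv\<^bsub>?G\<^esub> a) = Ident S X"
    if a: "a \<in> mor S X X" and aa: "a \<cdot> a = zero_mor S X X" for a
  proof -
    interpret R: group_hom ?G ?G "\<lambda>f. a \<cdot> f"
      by unfold_locales (rule Comp_hom_right[OF a])
    have i: "inv\<^bsub>?G\<^esub> a \<in> mor S X X" using a by simp
    have "(Ident S X \<otimes>\<^bsub>?G\<^esub> a) \<cdot> f = f \<otimes>\<^bsub>?G\<^esub> (a \<cdot> f)" if "f \<in> mor S X X" for f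
      using hom_mult[OF Comp_hom_left[OF that] Ident_in a] Ident_left[OF that] by simp
    then have "(Ident S X \<otimes>\<^bsub>?G\<^esub> a) \<cdot> (Ident S X \<otimes>\<^bsub>?G\<^esub> inv\<^bsub>?G\<^esub> a)
      = (Ident S X \<otimes>\<^bsub>?G\<^esub> inv\<^bsub>?G\<^esub> a) \<otimes>\<^bsub>?G\<^esub> (a \<cdot> (Ident S X \<otimes>\<^bsub>?G\<^esub> inv\<^bsub>?G\<^esub> a))"
      using i by simp
    also have "a \<cdot> (Ident S X \<otimes>\<^bsub>?G\<^esub> inv\<^bsub>?G\<^esub> a) = a"
      using R.hom_mult[OF Ident_in i] R.hom_inv[OF a] Ident_right[OF a] aa a by simp
    finally show ?thesis
      using a by (simp add: G.m_assoc)
  qed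
  have "inv\<^bsub>?G\<^esub> n \<cdot> inv\<^bsub>?G\<^esub> n = zero_mor S X X"
  proof -
    interpret R: group_hom ?G ?G "\<lambda>f. inv\<^bsub>?G\<^esub> n \<cdot> f"
      using n by unfold_locales (simp add: Comp_hom_right)
    interpret L: group_hom ?G ?G "\<lambda>f. f \<cdot> n"
      using n by unfold_locales (simp add: Comp_hom_left)
    show ?thesis
      using R.hom_inv[OF n] L.hom_inv[OF n] nn by simp
  qed
  then show ?thesis
    using *[of n] *[of "inv\<^bsub>?G\<^esub> n"] n nn by (simp add: inverse_mors_def)
qed

end


section \<open>Duality for extriangulated categories\<close>

lemma push_opp [simp]: "push (opp S) C a d = pull S C a d"
  by (simp add: push_def pull_def)

lemma pull_opp [simp]: "pull (opp S) A c d = push S A c d"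
  by (simp add: push_def pull_def)

lemma ext_morphism_opp [simp]:
  "ext_morphism (opp S) C A d C' A' d' a c \<longleftrightarrow> ext_morphism S A' C' d' A C d c a"
  by (auto simp: ext_morphism_def)

lemma (in additive_bifunctor) additive_bifunctor_opp: "additive_bifunctor (opp S)"
proof (intro additive_bifunctor.intro additive_bifunctor_axioms.intro, unfold opp_simps, goal_cases)
  case 1 show ?case by (rule additive_category_opp)
next
  case 2 show ?case by (rule Ext_comm_group)
next
  case 3 then show ?case using ExtMap_hom by simp
next
  case 4 then show ?case using ExtMap_Ident by simp
next
  case 5 then show ?case using ExtMap_Comp by simp
next
  case 6 then show ?case using ExtMap_add_right by simp
next
  case 7 then show ?case using ExtMap_add_left by simp
qed

lemma (in additive_category) seq_equiv_sym:
  assumes "(s, s') \<in> seq_equiv S A C"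
  shows "(s', s) \<in> seq_equiv S A C"
proof -
  obtain B x y B' x' y' where s: "s = (B, x, y)" "s' = (B', x', y')"
    by (metis surj_pair)
  then obtain b where m: "x \<in> mor S A B" "y \<in> mor S B C" "x' \<in> mor S A B'" "y' \<in> mor S B' C"
    and b': "b \<in> mor S B B'" "isomorphism S b" and e: "b \<cdot> x = x'" "y' \<cdot> b = y"
    using assms unfolding seq_equiv_def seqs_def by auto
  obtain c where b: "inverse_mors S B B' b c"
    using b' Hom_disjoint unfolding isomorphism_iff_inverse_mors inverse_mors_def by metis
  have bc: "b \<in> mor S B B'" "c \<in> mor S B' B" "c \<cdot> b = Ident S B" "b \<cdot> c = Ident S B'"
    using b by (auto simp: inverse_mors_def)
  have "c \<cdot> x' = x" "y \<cdot> c = y'"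
    using Comp_assoc[OF m(1) bc(1,2)] Comp_assoc[OF bc(2,1) m(4)] bc e
      Ident_left[OF m(1)] Ident_right[OF m(4)] by simp_all
  moreover have "isomorphism S c"
    using inverse_mors_sym[OF b] by (auto simp: isomorphism_iff_inverse_mors)
  ultimately show ?thesis
    using s m bc(2) by (auto simp: seq_equiv_def seqs_def)
qed

context additive_realization
begin

lemma etriangle_mor:
  assumes "etriangle S A B C x y d"
  shows "x \<in> mor S A B" "y \<in> mor S B C" "d \<in> Ext S C A"
proof -
  show d: "d \<in> Ext S C A" using assms by (simp add: etriangle_def)
  have "(B, x, y) \<in> Realize S C A d" using assms by (simp add: etriangle_def)
  then have "(B, x, y) \<in> seqs S A C"
    using Real_class[OF d] by (auto simp: quotient_def seq_equiv_def)
  then show "x \<in> mor S A B" "y \<in> mor S B C" by (auto simp: seqs_def)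
qed

lemma additive_realization_opp: "additive_realization (opp S)"
proof (intro additive_realization.intro additive_realization_axioms.intro additive_bifunctor_opp,
    goal_cases)
  case (1 d C A)
  then have "Realize S A C d \<in> seqs S C A // seq_equiv S C A"
    by (simp add: Real_class)
  then obtain s where s: "s \<in> seqs S C A" "Realize S A C d = seq_equiv S C A `` {s}"
    by (auto simp: quotient_def)
  obtain B x y where Bxy: "s = (B, x, y)" by (cases s)
  have "((B, y, x), (B', y', x')) \<in> seq_equiv (opp S) A C \<longleftrightarrow>
      ((B', x', y'), (B, x, y)) \<in> seq_equiv S C A" for B' x' y'
    unfolding seq_equiv_def seqs_def by auto
  then have "(B', y', x') \<in> Realize (opp S) C A d \<longleftrightarrow> ((B, y, x), (B', y', x')) \<in> seq_equiv (opp S) A C"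
    for B' x' y'
    using s(2) Bxy seq_equiv_sym by auto
  then have "Realize (opp S) C A d = seq_equiv (opp S) A C `` {(B, y, x)}"
    by auto
  moreover have "(B, y, x) \<in> seqs (opp S) A C"
    using s(1) Bxy by (auto simp: seqs_def)
  ultimately show ?case by (auto simp: quotient_def)
next
  case (2 C A d C' A' d' a c B x y B' x' y')
  then show ?case
    using Real_morphism[of A' C' d' A C d c a B' y' x' B y x] by auto
next
  case (3 A C P iA iC pA pC)
  then have "biproduct S A C P pA pC iA iC" by simp
  then show ?case
    using Real_zero[OF biproduct_swap] by simp
next
  case (4 A B C x y d A' B' C' x' y' d' PA iA iA' pA pA' PB iB iB' pB pB' PC iC iC' pC pC')
  then have t: "etriangle S C B A y x d" "etriangle S C' B' A' y' x' d'"
    and b: "biproduct S A A' PA pA pA' iA iA'" "biproduct S B B' PB pB pB' iB iB'"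
      "biproduct S C C' PC pC pC' iC iC'" by simp_all
  note m = etriangle_mor(1,2)[OF t(1)] etriangle_mor(1,2)[OF t(2)]
    b[unfolded biproduct_def]
  have "pB \<cdot> (y \<cdot> iC) = pB \<cdot> y \<cdot> iC" "pB' \<cdot> (y' \<cdot> iC') = pB' \<cdot> y' \<cdot> iC'"
    "pA \<cdot> (x \<cdot> iB) = pA \<cdot> x \<cdot> iB" "pA' \<cdot> (x' \<cdot> iB') = pA' \<cdot> x' \<cdot> iB'"
    using m Comp_assoc by metis+
  then show ?case
    using Real_sum[OF t b(3,2,1)] by simp
qed

end

lemma (in extriangulated) extriangulated_opp: "extriangulated (opp S)"
  using additive_realization_opp ET3 ET3_op ET4 ET4_op
  by (simp add: extriangulated_def extriangulated_axioms_def)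


section \<open>Exactness properties of triangles\<close>

context extriangulated
begin

lemma ET3_triangles:
  assumes "etriangle S A B C x y d" "etriangle S A' B' C' x' y' d'"
    and "a \<in> mor S A A'" "b \<in> mor S B B'" "b \<cdot> x = x' \<cdot> a"
  obtains c where "c \<in> mor S C C'" "c \<cdot> y = y' \<cdot> b" "push S C a d = pull S A' c d'"
proof -
  have "\<exists>c\<in>mor S C C'. c \<cdot> y = y' \<cdot> b \<and> push S C a d = pull S A' c d'"
    using ET3[unfolded ET3_def, rule_format, of A B C x y d A' B' C' x' y' d' a b] assms by simp
  then show ?thesis using that by blast
qed

lemma Ext_group: "group (ExtGrp S C A)"
  using Ext_comm_group[of C A] by (rule comm_group.axioms(2))

lemma push_zero: "a \<in> mor S A A' \<Longrightarrow> push S C a \<one>\<^bsub>ExtGrp S C A\<^esub> = \<one>\<^bsub>ExtGrp S C A'\<^esub>"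
  unfolding push_def using hom_one[OF ExtMap_hom[OF Ident_in] Ext_group Ext_group] by simp

lemma pull_zero: "c \<in> mor S C' C \<Longrightarrow> pull S A c \<one>\<^bsub>ExtGrp S C A\<^esub> = \<one>\<^bsub>ExtGrp S C' A\<^esub>"
  unfolding pull_def using hom_one[OF ExtMap_hom[OF _ Ident_in] Ext_group Ext_group] by simp

lemma push_Ident: "d \<in> Ext S C A \<Longrightarrow> push S C (Ident S A) d = d"
  by (simp add: push_def ExtMap_Ident)

lemma push_Comp:
  "\<lbrakk>a \<in> mor S A A'; a' \<in> mor S A' A''; d \<in> Ext S C A\<rbrakk> \<Longrightarrow>
    push S C (a' \<cdot> a) d = push S C a' (push S C a d)"
  unfolding push_def
  using ExtMap_Comp[of "Ident S C" C C "Ident S C" C a A A' a' A'' d] Ident_left[OF Ident_in] by simp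

lemma push_add:
  "\<lbrakk>a \<in> mor S A A'; a' \<in> mor S A A'; d \<in> Ext S C A\<rbrakk> \<Longrightarrow>
    push S C (a \<otimes>\<^bsub>HomGrp S A A'\<^esub> a') d = push S C a d \<otimes>\<^bsub>ExtGrp S C A'\<^esub> push S C a' d"
  unfolding push_def by (rule ExtMap_add_right[OF Ident_in])

lemma push_in: "a \<in> mor S A A' \<Longrightarrow> d \<in> Ext S C A \<Longrightarrow> push S C a d \<in> Ext S C A'"
  unfolding push_def using ExtMap_hom[OF Ident_in, of a A A' C] by (auto simp: hom_def)

text \<open>An isomorphism \<open>X \<rightarrow> Y\<close> makes \<open>X\<close> a biproduct of \<open>0\<close> and \<open>Y\<close>, so it belongs to a split triangle.\<close>

lemma etriangle_iso_deflation:
  assumes "inverse_mors S X Y f g" and "zero_obj S Z"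
  shows "etriangle S Z X Y (zero_mor S Z X) f \<one>\<^bsub>ExtGrp S Y Z\<^esub>"
  using Real_zero[OF biproduct_zero_iso[OF assms(2,1)]]
    monoid.one_closed[OF group.is_monoid[OF Ext_group]]
  by (simp add: etriangle_def)

lemma etriangle_iso_inflation:
  assumes "inverse_mors S X Y f g" and "zero_obj S Z"
  shows "etriangle S X Y Z f (zero_mor S Y Z) \<one>\<^bsub>ExtGrp S Z X\<^esub>"
  using extriangulated.etriangle_iso_deflation[OF extriangulated_opp, of Y X f g Z]
    assms by simp

text \<open>
  The next lemmas are fragments of the long exact sequences that arise from a triangle by applying
  \<open>Hom\<close>. Each compares the triangle with a split triangle \<open>X \<rightarrow> X \<rightarrow> 0\<close> or \<open>0 \<rightarrow> X \<rightarrow> X\<close>, by the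
  third axiom or by the lifting property of the realization.
\<close>

lemma etriangle_Comp_zero:
  assumes t: "etriangle S A B C x y d"
  shows "y \<cdot> x = zero_mor S A C"
proof -
  obtain Z where Z: "zero_obj S Z" using zero_exists by blast
  note m = etriangle_mor[OF t]
  obtain c where c: "c \<in> mor S Z C" "c \<cdot> zero_mor S A Z = y \<cdot> x"
    by (rule ET3_triangles[OF etriangle_iso_inflation[OF inverse_mors_Ident Z] t Ident_in m(1) refl])
  show ?thesis using c(2) Comp_zero_right[OF c(1)] by simp
qed

lemma push_inflation:
  assumes t: "etriangle S A B C x y d"
  shows "push S C x d = \<one>\<^bsub>ExtGrp S C B\<^esub>"
proof -
  obtain Z where Z: "zero_obj S Z" using zero_exists by blast
  note m = etriangle_mor[OF t]
  obtain c where "c \<in> mor S C Z" "push S C x d = pull S B c \<one>\<^bsub>ExtGrp S Z B\<^esub>"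
    by (rule ET3_triangles[OF t etriangle_iso_inflation[OF inverse_mors_Ident Z] m(1) Ident_in refl])
  then show ?thesis by (simp add: pull_zero)
qed

lemma deflation_weak_cokernel:
  assumes t: "etriangle S A B C x y d" and f: "f \<in> mor S B X" "f \<cdot> x = zero_mor S A X"
  obtains g where "g \<in> mor S C X" "g \<cdot> y = f"
proof -
  obtain Z where Z: "zero_obj S Z" using zero_exists by blast
  have sq: "f \<cdot> x = zero_mor S Z X \<cdot> zero_mor S A Z"
    unfolding f(2) by (rule Comp_zero_left[OF zero_mor_in, symmetric])
  obtain c where "c \<in> mor S C X" "c \<cdot> y = Ident S X \<cdot> f"
    by (rule ET3_triangles[OF t etriangle_iso_deflation[OF inverse_mors_Ident Z] zero_mor_in f(1) sq])
  then show ?thesis using that f(1) by (simp add: Ident_left)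
qed

lemma inflation_weak_kernel:
  assumes "etriangle S A B C x y d" and "f \<in> mor S X B" "y \<cdot> f = zero_mor S X C"
  obtains g where "g \<in> mor S X A" "x \<cdot> g = f"
  using extriangulated.deflation_weak_cokernel[OF extriangulated_opp, of C B A y x d f X] assms
  by auto

lemma factor_through_inflation:
  assumes t: "etriangle S A B C x y d" and n: "n \<in> mor S A X"
    and z: "push S C n d = \<one>\<^bsub>ExtGrp S C X\<^esub>"
  obtains m where "m \<in> mor S B X" "n = m \<cdot> x"
proof -
  obtain Z where Z: "zero_obj S Z" using zero_exists by blast
  note u = etriangle_iso_inflation[OF inverse_mors_Ident[of X] Z]
  have "ext_morphism S C A d Z X \<one>\<^bsub>ExtGrp S Z X\<^esub> n (zero_mor S C Z)"
    using etriangle_mor(3)[OF t] etriangle_mor(3)[OF u] n z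
    by (simp add: ext_morphism_def pull_zero[OF zero_mor_in])
  then obtain b where "b \<in> mor S B X" "b \<cdot> x = Ident S X \<cdot> n"
    using Real_morphism[OF _ t u] by blast
  then show ?thesis using that n by (simp add: Ident_left)
qed

lemma factor_through_deflation:
  assumes "etriangle S A B C x y d" and "n \<in> mor S X C"
    and "pull S A n d = \<one>\<^bsub>ExtGrp S X A\<^esub>"
  obtains m where "m \<in> mor S X B" "n = y \<cdot> m"
  using extriangulated.factor_through_inflation[OF extriangulated_opp, of C B A y x d n X] assms
  by auto

lemma conflation_mor:
  "conflation S A B C x y \<Longrightarrow> x \<in> mor S A B" "conflation S A B C x y \<Longrightarrow> y \<in> mor S B C"
  unfolding conflation_def using etriangle_mor by blast+

text \<open>
  An extension \<open>d\<close> of a zero object is zero, because \<open>d = (0 + 0)\<^sup>*d = d + d\<close>. Then the identity of \<open>A\<close>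
  factors through the inflation, which gives a left inverse; a right inverse lifts the identity of
  \<open>B\<close>, whose composite with the deflation to \<open>C = 0\<close> vanishes.
\<close>

lemma zero_cone_imp_iso:
  assumes cf: "conflation S A B C x y" and C: "zero_obj S C"
  shows "\<exists>r. inverse_mors S A B x r"
proof -
  obtain d where t: "etriangle S A B C x y d" using cf by (auto simp: conflation_def)
  note m = etriangle_mor[OF t]
  interpret E: comm_group "ExtGrp S C A" by (rule Ext_comm_group)
  have "d = pull S A (Ident S C) d"
    unfolding pull_def by (rule ExtMap_Ident[OF m(3), symmetric])
  also have "Ident S C = zero_mor S C C \<otimes>\<^bsub>HomGrp S C C\<^esub> zero_mor S C C"
    using C monoid.l_one[OF group.is_monoid[OF Hom_group] zero_mor_in] by (simp add: zero_obj_iff)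
  also have "pull S A \<dots> d = pull S A (zero_mor S C C) d \<otimes>\<^bsub>ExtGrp S C A\<^esub> pull S A (zero_mor S C C) d"
    unfolding pull_def by (rule ExtMap_add_left[OF zero_mor_in zero_mor_in Ident_in m(3)])
  also have "zero_mor S C C = Ident S C"
    using C by (simp add: zero_obj_iff)
  also have "pull S A (Ident S C) d = d"
    unfolding pull_def by (rule ExtMap_Ident[OF m(3)])
  finally have "d = \<one>\<^bsub>ExtGrp S C A\<^esub>"
    using m(3) by (metis E.r_cancel_one)
  then obtain r where r: "r \<in> mor S B A" "Ident S A = r \<cdot> x"
    using factor_through_inflation[OF t Ident_in] push_Ident[OF m(3)] by metis
  have "y \<cdot> Ident S B = zero_mor S B C"
    using into_zero_obj[OF C m(2)] by simp
  then obtain s where s: "s \<in> mor S B A" "x \<cdot> s = Ident S B"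
    by (rule inflation_weak_kernel[OF t Ident_in])
  have "s = r"
    using Comp_assoc[OF s(1) m(1) r(1)] r s Ident_left Ident_right by metis
  then show ?thesis using m r s by (auto simp: inverse_mors_def)
qed

lemma zero_cocone_imp_iso:
  assumes "conflation S A B C x y" and "zero_obj S A"
  shows "\<exists>r. inverse_mors S B C y r"
  using extriangulated.zero_cone_imp_iso[OF extriangulated_opp, of C B A y x] assms
  by (auto dest: inverse_mors_sym)

text \<open>
  If \<open>x\<close> is invertible, then \<open>d = 0\<close> follows from \<open>x\<^sub>*d = 0\<close>, so that the deflation \<open>y\<close> splits; and
  \<open>y = 0\<close> follows from \<open>yx = 0\<close>.
\<close>

lemma iso_imp_zero_cone:
  assumes cf: "conflation S A B C x y" and x: "inverse_mors S A B x r"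
  shows "zero_obj S C"
proof -
  obtain d where t: "etriangle S A B C x y d" using cf by (auto simp: conflation_def)
  note m = etriangle_mor[OF t]
  have r: "r \<in> mor S B A" "r \<cdot> x = Ident S A" "x \<cdot> r = Ident S B"
    using x by (auto simp: inverse_mors_def)
  have "d = push S C r (push S C x d)"
    using push_Comp[OF m(1) r(1) m(3)] r push_Ident[OF m(3)] by simp
  then have "d = \<one>\<^bsub>ExtGrp S C A\<^esub>"
    using push_inflation[OF t] push_zero[OF r(1)] by simp
  then obtain s where s: "s \<in> mor S C B" "Ident S C = y \<cdot> s"
    using factor_through_deflation[OF t Ident_in] pull_zero[OF Ident_in] by metis
  have "y = zero_mor S B C"
    using Comp_assoc[OF r(1) m(1,2)] etriangle_Comp_zero[OF t] r Ident_right[OF m(2)] by simp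
  then show ?thesis using s by (simp add: zero_obj_iff)
qed

text \<open>
  An endomorphism \<open>e\<close> of the first term of a triangle that fixes the inflation and the extension
  differs from the identity by some \<open>n\<close> with \<open>xn = 0\<close> and \<open>n\<^sub>*d = 0\<close>. The latter gives \<open>n = kx\<close> for
  some \<open>k\<close>, and so \<open>n\<^sup>2 = kxn = 0\<close>; hence \<open>1 + n\<close> is invertible.
\<close>

lemma fixes_triangle_imp_iso:
  assumes t: "etriangle S A B C x y d" and e: "e \<in> mor S A A"
    and fx: "x \<cdot> e = x" "push S C e d = d"
  shows "\<exists>r. inverse_mors S A A e r"
proof -
  let ?G = "HomGrp S A A"
  note m = etriangle_mor[OF t]
  interpret G: comm_group ?G by (rule Hom_comm_group)
  interpret E: comm_group "ExtGrp S C A" by (rule Ext_comm_group)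
  interpret H: group_hom ?G "HomGrp S A B" "\<lambda>f. x \<cdot> f"
    using Comp_hom_right[OF m(1)] Hom_group by (simp add: group_hom_def group_hom_axioms_def)
  define n where "n = inv\<^bsub>?G\<^esub> (Ident S A) \<otimes>\<^bsub>?G\<^esub> e"
  have n: "n \<in> mor S A A" using e by (simp add: n_def)
  have e': "e = Ident S A \<otimes>\<^bsub>?G\<^esub> n"
    using e by (simp add: n_def G.m_assoc[symmetric])
  have "x \<otimes>\<^bsub>HomGrp S A B\<^esub> (x \<cdot> n) = x"
    using fx(1) H.hom_mult[OF Ident_in n] Ident_right[OF m(1)] e' by simp
  then have xn: "x \<cdot> n = zero_mor S A B"
    by (simp add: H.H.l_cancel_one[OF m(1) Comp_in[OF n m(1)]])
  have "d \<otimes>\<^bsub>ExtGrp S C A\<^esub> push S C n d = d"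
    using fx(2) push_add[OF Ident_in n m(3)] push_Ident[OF m(3)] e' by simp
  then have "push S C n d = \<one>\<^bsub>ExtGrp S C A\<^esub>"
    by (simp add: E.l_cancel_one[OF m(3) push_in[OF n m(3)]])
  then obtain k where k: "k \<in> mor S B A" "n = k \<cdot> x"
    by (rule factor_through_inflation[OF t n])
  have "n \<cdot> n = k \<cdot> (x \<cdot> n)"
    using Comp_assoc[OF n m(1) k(1)] k(2) by simp
  then have "n \<cdot> n = zero_mor S A A"
    using xn k by simp
  then show ?thesis
    using unipotent_inverse_mors[OF n] e' by auto
qed

text \<open>
  The cocone of a deflation is determined up to isomorphism: by the previous lemma, the two
  composites of comparison morphisms in opposite directions are isomorphisms.
\<close>

lemma cocone_iso:
  assumes cf: "conflation S A B C x y" and cf': "conflation S A' B' C' x' y'"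
    and b: "inverse_mors S B B' b b'" and c: "inverse_mors S C C' c c'"
    and sq: "c \<cdot> y = y' \<cdot> b"
  shows "iso_obj S A A'"
proof -
  obtain d where t: "etriangle S A B C x y d" using cf by (auto simp: conflation_def)
  obtain d' where t': "etriangle S A' B' C' x' y' d'" using cf' by (auto simp: conflation_def)
  note m = etriangle_mor[OF t] and m' = etriangle_mor[OF t']
  have bb: "b \<in> mor S B B'" "b' \<in> mor S B' B" "b' \<cdot> b = Ident S B" "b \<cdot> b' = Ident S B'"
    and cc: "c \<in> mor S C C'" "c' \<in> mor S C' C" "c' \<cdot> c = Ident S C" "c \<cdot> c' = Ident S C'"
    using b c by (auto simp: inverse_mors_def)
  have sq': "c' \<cdot> y' = y \<cdot> b'"
  proof -
    have "c' \<cdot> y' = (c' \<cdot> y') \<cdot> (b \<cdot> b')"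
      using bb Ident_right[OF Comp_in[OF m'(2) cc(2)]] by simp
    also have "\<dots> = (c' \<cdot> (y' \<cdot> b)) \<cdot> b'"
      using Comp_assoc[OF bb(2,1) Comp_in[OF m'(2) cc(2)]] Comp_assoc[OF bb(1) m'(2) cc(2)] by simp
    also have "\<dots> = ((c' \<cdot> c) \<cdot> y) \<cdot> b'"
      using Comp_assoc[OF m(2) cc(1,2)] sq by simp
    finally show ?thesis using cc Ident_left[OF m(2)] by simp
  qed
  \<comment> \<open>The dual of the third axiom completes \<open>(b, c)\<close> to a morphism of triangles.\<close>
  have comparison: "\<exists>a. a \<in> mor S A A' \<and> x' \<cdot> a = b \<cdot> x \<and> push S C a d = pull S A' c d'"
    if "etriangle S A B C x y d" "etriangle S A' B' C' x' y' d'" "b \<in> mor S B B'" "c \<in> mor S C C'"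
      "c \<cdot> y = y' \<cdot> b" for A B C x y d A' B' C' x' y' d' b c
    using that extriangulated.ET3_triangles[OF extriangulated_opp, of C' B' A' y' x' d' C B A y x d c b]
    by (simp) metis
  obtain a where a: "a \<in> mor S A A'" "x' \<cdot> a = b \<cdot> x" "push S C a d = pull S A' c d'"
    using comparison[OF t t' bb(1) cc(1) sq] by blast
  obtain a' where a': "a' \<in> mor S A' A" "x \<cdot> a' = b' \<cdot> x'" "push S C' a' d' = pull S A c' d"
    using comparison[OF t' t bb(2) cc(2) sq'] by blast
  \<comment> \<open>Stated for arbitrary triangles, in order to be used for \<open>a'a\<close> and, with the roles exchanged, for \<open>aa'\<close>.\<close>
  have roundtrip: "\<exists>r. inverse_mors S A A (a' \<cdot> a) r"
    if t: "etriangle S A B C x y d" and t': "etriangle S A' B' C' x' y' d'"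
      and bb: "b \<in> mor S B B'" "b' \<in> mor S B' B" "b' \<cdot> b = Ident S B"
      and cc: "c \<in> mor S C C'" "c' \<in> mor S C' C" "c' \<cdot> c = Ident S C"
      and a: "a \<in> mor S A A'" "x' \<cdot> a = b \<cdot> x" "push S C a d = pull S A' c d'"
      and a': "a' \<in> mor S A' A" "x \<cdot> a' = b' \<cdot> x'" "push S C' a' d' = pull S A c' d"
    for A B C x y d A' B' C' x' y' d' b c a b' c' a'
  proof (rule fixes_triangle_imp_iso[OF t Comp_in[OF a(1) a'(1)]])
    note m = etriangle_mor[OF t] and m' = etriangle_mor[OF t']
    have "x \<cdot> (a' \<cdot> a) = b' \<cdot> (x' \<cdot> a)"
      using Comp_assoc[OF a(1) a'(1) m(1)] Comp_assoc[OF a(1) m'(1) bb(2)] a' by simp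
    also have "\<dots> = x"
      using Comp_assoc[OF m(1) bb(1,2)] a bb Ident_left[OF m(1)] by simp
    finally show "x \<cdot> (a' \<cdot> a) = x" .
    have "push S C (a' \<cdot> a) d = push S C a' (pull S A' c d')"
      using push_Comp[OF a(1) a'(1) m(3)] a by simp
    also have "\<dots> = pull S A c (push S C' a' d')"
      unfolding push_def pull_def
      using ExtMap_Comp[OF cc(1) Ident_in Ident_in a'(1) m'(3)]
        ExtMap_Comp[OF Ident_in cc(1) a'(1) Ident_in m'(3)]
        Ident_left[OF cc(1)] Ident_right[OF cc(1)] Ident_left[OF a'(1)] Ident_right[OF a'(1)] by simp
    also have "\<dots> = pull S A (c' \<cdot> c) d"
      unfolding a' pull_def
      using ExtMap_Comp[OF cc(2,1) Ident_in Ident_in m(3)] Ident_left[OF Ident_in] by simp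
    also have "\<dots> = d"
      by (simp add: cc(3) pull_def ExtMap_Ident[OF m(3)])
    finally show "push S C (a' \<cdot> a) d = d" .
  qed
  obtain r where r: "inverse_mors S A A (a' \<cdot> a) r"
    using roundtrip[OF t t' bb(1,2,3) cc(1,2,3) a a'] by blast
  obtain r' where r': "inverse_mors S A' A' (a \<cdot> a') r'"
    using roundtrip[OF t' t bb(2,1,4) cc(2,1,4) a' a] by blast
  have rr: "r \<in> mor S A A" "r \<cdot> (a' \<cdot> a) = Ident S A" "r' \<in> mor S A' A'" "(a \<cdot> a') \<cdot> r' = Ident S A'"
    using r r' by (auto simp: inverse_mors_def)
  have l: "(r \<cdot> a') \<cdot> a = Ident S A"
    using Comp_assoc[OF a(1) a'(1) rr(1)] rr by simp
  have s: "a \<cdot> (a' \<cdot> r') = Ident S A'"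
    using Comp_assoc[OF rr(3) a'(1) a(1)] rr by simp
  have "r \<cdot> a' = a' \<cdot> r'"
    using Comp_assoc[OF Comp_in[OF rr(3) a'(1)] a(1) Comp_in[OF a'(1) rr(1)]] l s
      Ident_left[OF Comp_in[OF rr(3) a'(1)]] Ident_right[OF Comp_in[OF a'(1) rr(1)]] by simp
  then have "inverse_mors S A A' a (r \<cdot> a')"
    using l s a(1) Comp_in[OF a'(1) rr(1)] by (simp add: inverse_mors_def)
  then show ?thesis by (auto simp: iso_obj_iff)
qed

lemma cone_iso:
  assumes "conflation S A B C x y" and "conflation S A' B' C' x' y'"
    and "inverse_mors S A A' a a'" and "inverse_mors S B B' b b'"
    and "b \<cdot> x = x' \<cdot> a"
  shows "iso_obj S C C'"
proof -
  have "iso_obj (opp S) C' C"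
    using extriangulated.cocone_iso[OF extriangulated_opp, of C' B' A' y' x' C B A y x b b' a a']
      assms by simp
  then show ?thesis
    by (simp add: iso_obj_def)
qed

text \<open>This is the fourth axiom in the opposite category, whose inflations are the deflations of \<open>S\<close>.\<close>

lemma deflation_Comp:
  assumes "conflation S K X Y k f" and "conflation S L Y Z l g"
  shows "\<exists>M m. conflation S M X Z m (g \<cdot> f)"
proof -
  obtain d d' where "etriangle (opp S) Z Y L g l d'" "etriangle (opp S) Y X K f k d"
    using assms by (auto simp: conflation_def)
  then obtain E h' d'' where "etriangle (opp S) Z X E (f \<cdot>\<^bsub>opp S\<^esub> g) h' d''"
    using ET4_op[unfolded ET4_def, rule_format, OF conjI] by blast
  then show ?thesis by (auto simp: conflation_def)
qed

lemma inflation_Comp: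
  assumes "conflation S A B D f f'" and "conflation S B C F g g'"
  shows "\<exists>E h' d e. conflation S A C E (g \<cdot> f) h' \<and> conflation S D E F d e"
proof -
  obtain \<delta> \<delta>' where t: "etriangle S A B D f f' \<delta>" "etriangle S B C F g g' \<delta>'"
    using assms by (auto simp: conflation_def)
  obtain E h' d e \<delta>'' where "etriangle S A C E (g \<cdot> f) h' \<delta>''"
    "etriangle S D E F d e (push S F f' \<delta>')"
    using ET4[unfolded ET4_def, rule_format, OF conjI[OF t]] by (elim exE conjE) (rule that)
  then show ?thesis by (auto simp: conflation_def)
qed

end


section \<open>Functors and adjunctions\<close>

locale additive_cat_functor =
  source: additive_category S + target: additive_category T + additive_functor S T F
  for S :: "('o1, 'm1, 'e1) extcat" and T :: "('o2, 'm2, 'e2) extcat"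
    and F :: "('o1, 'm1, 'o2, 'm2) cfunctor"
begin

lemma FM_mor: "f \<in> mor S X Y \<Longrightarrow> FM F f \<in> mor T (FO F X) (FO F Y)"
  using FM_hom[of X Y] by (auto simp: hom_def)

lemma FM_zero: "FM F (zero_mor S X Y) = zero_mor T (FO F X) (FO F Y)"
  by (rule hom_one[OF FM_hom source.Hom_group target.Hom_group])

lemma FM_inverse_mors:
  assumes "inverse_mors S X Y f g"
  shows "inverse_mors T (FO F X) (FO F Y) (FM F f) (FM F g)"
proof -
  have m: "f \<in> mor S X Y" "g \<in> mor S Y X" and e: "g \<cdot>\<^bsub>S\<^esub> f = Ident S X" "f \<cdot>\<^bsub>S\<^esub> g = Ident S Y"
    using assms by (auto simp: inverse_mors_def)
  show ?thesis
    using FM_mor[OF m(1)] FM_mor[OF m(2)] FM_Comp[OF m(1,2)] FM_Comp[OF m(2,1)] e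
    by (simp add: inverse_mors_def FM_Ident)
qed

lemma FO_iso_obj: "iso_obj S X Y \<Longrightarrow> iso_obj T (FO F X) (FO F Y)"
  unfolding source.iso_obj_iff target.iso_obj_iff using FM_inverse_mors by blast

lemma FO_zero_obj: "zero_obj S Z \<Longrightarrow> zero_obj T (FO F Z)"
  unfolding source.zero_obj_iff target.zero_obj_iff using FM_Ident[of Z] FM_zero[of Z Z] by simp

lemma additive_cat_functor_opp: "additive_cat_functor (opp S) (opp T) F"
proof (intro additive_cat_functor.intro source.additive_category_opp target.additive_category_opp)
  show "additive_functor (opp S) (opp T) F"
    using FM_hom FM_Ident FM_Comp by unfold_locales simp_all
qed

end

lemma exact_functor_conflation:
  "exact_functor S T F \<Longrightarrow> conflation S A B C x y \<Longrightarrow>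
    conflation T (FO F A) (FO F B) (FO F C) (FM F x) (FM F y)"
  unfolding exact_functor_def conflation_def by blast

text \<open>The cone of \<open>F x\<close> is the object that the third condition in the definition of left exactness
  attaches to the extension realized by the given conflation.\<close>

lemma left_exact_functor_inflation:
  assumes "left_exact_functor S T F" and "conflation S A B C x y"
  shows "\<exists>K q. conflation T (FO F A) (FO F B) K (FM F x) q"
proof -
  obtain d where "etriangle (opp S) C B A y x d"
    using assms(2) by (auto simp: conflation_def)
  moreover obtain K \<eta> where "\<And>A B C f g d. etriangle (opp S) A B C f g d \<Longrightarrow>
      \<exists>q. etriangle (opp T) (K C A d) (FO F B) (FO F C) q (FM F g) (\<eta> C A d)"
    using assms(1) unfolding left_exact_functor_def right_exact_functor_def by metis
  ultimately show ?thesis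
    by (metis conflation_def etriangle_opp)
qed

lemma fully_faithful_opp [simp]:
  "fully_faithful (opp S) (opp T) F \<longleftrightarrow> fully_faithful S T F"
  by (auto simp: fully_faithful_def)

locale adjoint_pair =
  L: additive_cat_functor S T L + R: additive_cat_functor T S R + adjunction S T L R un co
  for S :: "('o1, 'm1, 'e1) extcat" and T :: "('o2, 'm2, 'e2) extcat"
    and L :: "('o1, 'm1, 'o2, 'm2) cfunctor" and R :: "('o2, 'm2, 'o1, 'm1) cfunctor"
    and un :: "'o1 \<Rightarrow> 'm1" and co :: "'o2 \<Rightarrow> 'm2"
begin

lemma adjoint_pair_opp: "adjoint_pair (opp T) (opp S) R L co un"
proof (intro adjoint_pair.intro L.additive_cat_functor_opp R.additive_cat_functor_opp)
  show "adjunction (opp T) (opp S) R L co un"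
    using un_mor un_natural co_mor co_natural triangle_left triangle_right
    by unfold_locales simp_all
qed

text \<open>If \<open>g\<close> is the preimage of the counit at \<open>L X\<close> under \<open>L\<close>, then the triangle identities and the
  naturality of the unit say that \<open>g\<close> is inverse to the unit at \<open>X\<close>.\<close>

lemma unit_iso:
  assumes ff: "fully_faithful S T L"
  shows "\<exists>r. inverse_mors S X (FO R (FO L X)) (un X) r"
proof -
  have bij: "bij_betw (FM L) (mor S X Y) (mor T (FO L X) (FO L Y))" for X Y
    using ff by (simp add: fully_faithful_def)
  have "co (FO L X) \<in> FM L ` mor S (FO R (FO L X)) X"
    using bij_betw_imp_surj_on[OF bij] co_mor by simp
  then obtain g where g: "g \<in> mor S (FO R (FO L X)) X" "FM L g = co (FO L X)"
    by force
  have "FM L (g \<cdot>\<^bsub>S\<^esub> un X) = FM L (Ident S X)"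
    using L.FM_Comp[OF un_mor g(1)] g(2) triangle_left by (simp add: L.FM_Ident)
  then have "g \<cdot>\<^bsub>S\<^esub> un X = Ident S X"
    by (rule inj_onD[OF bij_betw_imp_inj_on[OF bij] _ L.source.Comp_in[OF un_mor g(1)] L.source.Ident_in])
  moreover have "un X \<cdot>\<^bsub>S\<^esub> g = Ident S (FO R (FO L X))"
    using un_natural[OF g(1)] g(2) triangle_right by simp
  ultimately show ?thesis
    using g(1) un_mor by (auto simp: inverse_mors_def)
qed

text \<open>By a triangle identity, \<open>R (co Y)\<close> is a left inverse of the unit at \<open>R Y\<close>, which is invertible.\<close>

lemma FM_counit_iso:
  assumes ff: "fully_faithful S T L"
  shows "\<exists>r. inverse_mors S (FO R (FO L (FO R Y))) (FO R Y) (FM R (co Y)) r"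
proof -
  let ?X = "FO R Y" and ?g = "FM R (co Y)"
  obtain r where r: "inverse_mors S ?X (FO R (FO L ?X)) (un ?X) r"
    using unit_iso[OF ff] by blast
  have m: "r \<in> mor S (FO R (FO L ?X)) ?X" "un ?X \<cdot>\<^bsub>S\<^esub> r = Ident S (FO R (FO L ?X))"
    using r by (auto simp: inverse_mors_def)
  have g: "?g \<in> mor S (FO R (FO L ?X)) ?X"
    by (rule R.FM_mor[OF co_mor])
  have "?g = (?g \<cdot>\<^bsub>S\<^esub> un ?X) \<cdot>\<^bsub>S\<^esub> r"
    using L.source.Comp_assoc[OF m(1) un_mor g] m(2) L.source.Ident_right[OF g] by simp
  also have "\<dots> = r"
    using triangle_right L.source.Ident_left[OF m(1)] by simp
  finally show ?thesis using inverse_mors_sym[OF r] by auto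
qed

lemma counit_iso:
  "fully_faithful T S R \<Longrightarrow> \<exists>r. inverse_mors T (FO L (FO R Y)) Y (co Y) r"
  using adjoint_pair.unit_iso[OF adjoint_pair_opp, of Y] by (auto dest: inverse_mors_sym)

lemma FM_unit_iso:
  "fully_faithful T S R \<Longrightarrow>
    \<exists>r. inverse_mors T (FO L X) (FO L (FO R (FO L X))) (FM L (un X)) r"
  using adjoint_pair.FM_counit_iso[OF adjoint_pair_opp, of X] by (auto dest: inverse_mors_sym)

text \<open>A morphism \<open>f : X \<rightarrow> R Y\<close> is the composite of \<open>un X\<close> with the image under \<open>R\<close> of its transpose.\<close>

lemma transpose_zero:
  assumes h: "\<And>h. h \<in> mor T (FO L X) Y \<Longrightarrow> h = zero_mor T (FO L X) Y"
    and f: "f \<in> mor S X (FO R Y)"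
  shows "f = zero_mor S X (FO R Y)"
proof -
  note Lf = L.FM_mor[OF f]
  have "f = FM R (co Y) \<cdot>\<^bsub>S\<^esub> (un (FO R Y) \<cdot>\<^bsub>S\<^esub> f)"
    using L.source.Comp_assoc[OF f un_mor R.FM_mor[OF co_mor]] triangle_right
      L.source.Ident_left[OF f] by simp
  also have "\<dots> = FM R (co Y \<cdot>\<^bsub>T\<^esub> FM L f) \<cdot>\<^bsub>S\<^esub> un X"
    using L.source.Comp_assoc[OF un_mor R.FM_mor[OF Lf] R.FM_mor[OF co_mor]]
      un_natural[OF f] R.FM_Comp[OF Lf co_mor] by simp
  also have "co Y \<cdot>\<^bsub>T\<^esub> FM L f = zero_mor T (FO L X) Y"
    by (rule h[OF L.target.Comp_in[OF Lf co_mor]])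
  finally show ?thesis
    using L.source.Comp_zero_left[OF un_mor] by (simp add: R.FM_zero)
qed

end

text \<open>If \<open>R\<^sub>1 R\<^sub>2 = 0\<close>, then \<open>Hom (L\<^sub>2 L\<^sub>1 X, Y) = Hom (X, R\<^sub>1 R\<^sub>2 Y) = 0\<close> for all \<open>Y\<close>.\<close>

lemma left_adjoints_Comp_zero:
  assumes "adjoint_pair S T L1 R1 un1 co1" and "adjoint_pair T U L2 R2 un2 co2"
    and zero: "\<And>Y. zero_obj S (FO R1 (FO R2 Y))"
  shows "zero_obj U (FO L2 (FO L1 X))"
proof -
  interpret P: adjoint_pair S T L1 R1 un1 co1 by fact
  interpret Q: adjoint_pair T U L2 R2 un2 co2 by fact
  interpret P': adjoint_pair "opp T" "opp S" R1 L1 co1 un1 by (rule P.adjoint_pair_opp)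
  have "h = zero_mor T (FO L1 X) (FO R2 Y)" if "h \<in> mor T (FO L1 X) (FO R2 Y)" for h Y
    using P'.transpose_zero[of "FO R2 Y" X h] P.L.source.into_zero_obj[OF zero] that by simp
  then have un: "un2 (FO L1 X) = zero_mor T (FO L1 X) (FO R2 (FO L2 (FO L1 X)))"
    using Q.un_mor by blast
  show ?thesis
    using Q.triangle_left[of "FO L1 X"] un Q.L.target.Comp_zero_right[OF Q.co_mor]
    by (simp add: Q.L.FM_zero Q.L.target.zero_obj_iff)
qed

lemma right_adjoints_Comp_zero:
  assumes "adjoint_pair S T L1 R1 un1 co1" and "adjoint_pair T U L2 R2 un2 co2"
    and "\<And>X. zero_obj U (FO L2 (FO L1 X))"
  shows "zero_obj S (FO R1 (FO R2 Y))"
  using left_adjoints_Comp_zero[OF adjoint_pair.adjoint_pair_opp[OF assms(2)]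
      adjoint_pair.adjoint_pair_opp[OF assms(1)]] assms(3) by simp


section \<open>Gluing torsion pairs along a recollement\<close>

text \<open>
  A recollement with chosen units and counits. The equality of the essential image of \<open>i\<close> and the
  kernel of \<open>j\<close> enters in the form \<open>j i = 0\<close>.
\<close>

locale recollement_data =
  A: extriangulated \<A> + B: extriangulated \<B> + C: extriangulated \<C> +
  iL_i: adjoint_pair \<B> \<A> iL i un_iL co_iL + i_iR: adjoint_pair \<A> \<B> i iR un_iR co_iR +
  jL_j: adjoint_pair \<C> \<B> jL j un_jL co_jL + j_jR: adjoint_pair \<B> \<C> j jR un_jR co_jR
  for \<A> :: "('oa, 'ma, 'ea) extcat" and \<B> :: "('ob, 'mb, 'eb) extcat"
    and \<C> :: "('oc, 'mc, 'ec) extcat"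
    and iL i iR jL j jR un_iL co_iL un_iR co_iR un_jL co_jL un_jR co_jR +
  assumes i_exact: "exact_functor \<A> \<B> i" and j_exact: "exact_functor \<B> \<C> j"
    and jR_left_exact: "left_exact_functor \<C> \<B> jR"
    and i_ff: "fully_faithful \<A> \<B> i" and jL_ff: "fully_faithful \<C> \<B> jL"
    and jR_ff: "fully_faithful \<C> \<B> jR"
    and j_i_zero: "zero_obj \<C> (FO j (FO i X))"
    and left_exact_seq4: "\<exists>A h. left_exact_seq4 \<B> (FO i (FO iR Y)) Y (FO jR (FO j Y)) (FO i A)
      (co_iR Y) (un_jR Y) h"
    and right_exact_seq4: "\<exists>A h. right_exact_seq4 \<B> (FO i A) (FO jL (FO j Y)) Y (FO i (FO iL Y))
      h (co_jL Y) (un_iL Y)"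
begin

lemma iL_jL_zero: "zero_obj \<A> (FO iL (FO jL X))"
  using left_adjoints_Comp_zero[OF jL_j.adjoint_pair_axioms iL_i.adjoint_pair_axioms j_i_zero] .

lemma iR_jR_zero: "zero_obj \<A> (FO iR (FO jR X))"
  using right_adjoints_Comp_zero[OF i_iR.adjoint_pair_axioms j_jR.adjoint_pair_axioms j_i_zero] .

lemma iL_i_iso: "iso_obj \<A> (FO iL (FO i X)) X"
  using iL_i.counit_iso[OF i_ff] unfolding A.iso_obj_iff by blast

lemma iR_i_iso: "iso_obj \<A> X (FO iR (FO i X))"
  using i_iR.unit_iso[OF i_ff] unfolding A.iso_obj_iff by blast

lemma j_jL_iso: "iso_obj \<C> X (FO j (FO jL X))"
  using jL_j.unit_iso[OF jL_ff] unfolding C.iso_obj_iff by blast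

lemma j_jR_iso: "iso_obj \<C> (FO j (FO jR X)) X"
  using j_jR.counit_iso[OF jR_ff] unfolding C.iso_obj_iff by blast

text \<open>
  Applying \<open>iR\<close> to the two triangles \<open>i iR Y \<rightarrow> Y \<rightarrow> K\<close> and \<open>K \<rightarrow> jR j Y \<rightarrow> i A\<close>
  yields \<open>iR K = 0\<close>, because \<open>iR\<close> inverts the counit, and then \<open>A = iR i A = iR jR j Y = 0\<close>.
\<close>

lemma iR_exact_imp_triangle:
  assumes iR: "exact_functor \<B> \<A> iR"
  obtains K g1 g2 d r where "etriangle \<B> (FO i (FO iR Y)) Y K (co_iR Y) g1 d"
    "inverse_mors \<B> K (FO jR (FO j Y)) g2 r" "un_jR Y = g2 \<cdot>\<^bsub>\<B>\<^esub> g1"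
proof -
  obtain A h K g1 g2 d d' where t: "etriangle \<B> (FO i (FO iR Y)) Y K (co_iR Y) g1 d"
    and t': "etriangle \<B> K (FO jR (FO j Y)) (FO i A) g2 h d'" and e: "un_jR Y = g2 \<cdot>\<^bsub>\<B>\<^esub> g1"
    using left_exact_seq4[of Y] unfolding left_exact_seq4_def by blast
  have cf: "conflation \<B> (FO i (FO iR Y)) Y K (co_iR Y) g1"
    "conflation \<B> K (FO jR (FO j Y)) (FO i A) g2 h"
    using t t' by (auto simp: conflation_def)
  obtain r where "inverse_mors \<A> (FO iR (FO i (FO iR Y))) (FO iR Y) (FM iR (co_iR Y)) r"
    using i_iR.FM_counit_iso[OF i_ff] by blast
  then have "zero_obj \<A> (FO iR K)"
    using A.iso_imp_zero_cone exact_functor_conflation[OF iR cf(1)] by blast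
  then have "iso_obj \<A> (FO iR (FO jR (FO j Y))) (FO iR (FO i A))"
    using A.zero_cocone_imp_iso[OF exact_functor_conflation[OF iR cf(2)]] by (auto simp: A.iso_obj_iff)
  then have "zero_obj \<A> A"
    using A.zero_obj_iso_obj iR_jR_zero A.iso_obj_sym[OF iR_i_iso] by blast
  then obtain r where "inverse_mors \<B> K (FO jR (FO j Y)) g2 r"
    using B.zero_cone_imp_iso[OF cf(2)] iL_i.R.FO_zero_obj by blast
  then show ?thesis using that t e by blast
qed

lemma unit_jR_deflation:
  assumes "exact_functor \<B> \<A> iR"
  shows "\<exists>W w. conflation \<B> W Y (FO jR (FO j Y)) w (un_jR Y)"
proof -
  obtain K g1 g2 d r where t: "etriangle \<B> (FO i (FO iR Y)) Y K (co_iR Y) g1 d"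
    and g2: "inverse_mors \<B> K (FO jR (FO j Y)) g2 r" and e: "un_jR Y = g2 \<cdot>\<^bsub>\<B>\<^esub> g1"
    by (rule iR_exact_imp_triangle[OF assms])
  obtain Z where Z: "zero_obj \<B> Z" using B.zero_exists by blast
  have "conflation \<B> (FO i (FO iR Y)) Y K (co_iR Y) g1"
    "conflation \<B> Z K (FO jR (FO j Y)) (zero_mor \<B> Z K) g2"
    using t B.etriangle_iso_deflation[OF g2 Z] by (auto simp: conflation_def)
  then show ?thesis
    unfolding e by (rule B.deflation_Comp)
qed

lemma unit_iL_deflation: "\<exists>W w. conflation \<B> W Y (FO i (FO iL Y)) w (un_iL Y)"
  using right_exact_seq4[of Y] unfolding right_exact_seq4_def conflation_def by (elim exE conjE) (intro exI)

text \<open>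
  A morphism \<open>X \<rightarrow> Y\<close> becomes zero in \<open>jR j Y\<close> if \<open>Hom (j X, j Y) = 0\<close>, and so it lifts to \<open>i iR Y\<close>.
  The lift is zero if \<open>Hom (iL X, iR Y) = 0\<close>.
\<close>

lemma glued_Hom_zero:
  assumes iR: "exact_functor \<B> \<A> iR"
    and hA: "\<And>h. h \<in> mor \<A> (FO iL X) (FO iR Y) \<Longrightarrow> h = zero_mor \<A> (FO iL X) (FO iR Y)"
    and hC: "\<And>h. h \<in> mor \<C> (FO j X) (FO j Y) \<Longrightarrow> h = zero_mor \<C> (FO j X) (FO j Y)"
    and f: "f \<in> mor \<B> X Y"
  shows "f = zero_mor \<B> X Y"
proof -
  obtain K g1 g2 d r where t: "etriangle \<B> (FO i (FO iR Y)) Y K (co_iR Y) g1 d"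
    and g2: "inverse_mors \<B> K (FO jR (FO j Y)) g2 r" and e: "un_jR Y = g2 \<cdot>\<^bsub>\<B>\<^esub> g1"
    by (rule iR_exact_imp_triangle[OF iR])
  note g1 = B.etriangle_mor(2)[OF t]
  have gr: "g2 \<in> mor \<B> K (FO jR (FO j Y))" "r \<in> mor \<B> (FO jR (FO j Y)) K"
    "r \<cdot>\<^bsub>\<B>\<^esub> g2 = Ident \<B> K"
    using g2 by (auto simp: inverse_mors_def)
  have "un_jR Y \<cdot>\<^bsub>\<B>\<^esub> f = zero_mor \<B> X (FO jR (FO j Y))"
    by (rule j_jR.transpose_zero[OF hC B.Comp_in[OF f j_jR.un_mor]])
  then have "g2 \<cdot>\<^bsub>\<B>\<^esub> (g1 \<cdot>\<^bsub>\<B>\<^esub> f) = zero_mor \<B> X (FO jR (FO j Y))"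
    using B.Comp_assoc[OF f g1 gr(1)] e by simp
  then have "g1 \<cdot>\<^bsub>\<B>\<^esub> f = zero_mor \<B> X K"
    using B.Comp_assoc[OF B.Comp_in[OF f g1] gr(1,2)] gr(3) B.Ident_left[OF B.Comp_in[OF f g1]]
      B.Comp_zero_right[OF gr(2)] by simp
  then obtain g where g: "g \<in> mor \<B> X (FO i (FO iR Y))" "co_iR Y \<cdot>\<^bsub>\<B>\<^esub> g = f"
    by (rule B.inflation_weak_kernel[OF t f])
  have "g = zero_mor \<B> X (FO i (FO iR Y))"
    by (rule iL_i.transpose_zero[OF hA g(1)])
  then show ?thesis
    using g(2) B.Comp_zero_right[OF i_iR.co_mor] by simp
qed

text \<open>
  A torsion sequence \<open>T\<^sub>2 \<rightarrow> j X \<rightarrow> F\<^sub>2\<close> gives an inflation \<open>jR T\<^sub>2 \<rightarrow> jR j X\<close>. Let \<open>K\<close> be its cone and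
  \<open>Y\<close> the cocone of \<open>X \<rightarrow> jR j X \<rightarrow> K\<close>. A torsion sequence \<open>T\<^sub>1 \<rightarrow> iL Y \<rightarrow> F\<^sub>1\<close> gives a deflation
  \<open>Y \<rightarrow> i iL Y \<rightarrow> i F\<^sub>1\<close>; let \<open>U\<close> be its cocone. The fourth axiom for the inflations
  \<open>U \<rightarrow> Y \<rightarrow> X\<close> yields triangles \<open>U \<rightarrow> X \<rightarrow> V\<close> and \<open>i F\<^sub>1 \<rightarrow> V \<rightarrow> K\<close>. Applying the exact
  functors \<open>j\<close>, \<open>iL\<close>, \<open>iR\<close> to these triangles identifies, up to isomorphism, \<open>iL U\<close> with \<open>T\<^sub>1\<close>,
  \<open>j U\<close> and \<open>j Y\<close> with \<open>T\<^sub>2\<close>, \<open>iR V\<close> with \<open>F\<^sub>1\<close>, and \<open>j V\<close> and \<open>j K\<close> with \<open>F\<^sub>2\<close>.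
\<close>

lemma glued_conflation:
  assumes iR: "exact_functor \<B> \<A> iR" and iL: "exact_functor \<B> \<A> iL"
    and tA: "torsion_pair \<A> \<T>\<^sub>1 \<F>\<^sub>1" and tC: "torsion_pair \<C> \<T>\<^sub>2 \<F>\<^sub>2"
  shows "\<exists>U V u v. conflation \<B> U X V u v \<and>
    FO iL U \<in> \<T>\<^sub>1 \<and> FO j U \<in> \<T>\<^sub>2 \<and> FO iR V \<in> \<F>\<^sub>1 \<and> FO j V \<in> \<F>\<^sub>2"
proof -
  have closed: "\<And>X Y. X \<in> \<T>\<^sub>1 \<Longrightarrow> iso_obj \<A> X Y \<Longrightarrow> Y \<in> \<T>\<^sub>1"
    "\<And>X Y. X \<in> \<F>\<^sub>1 \<Longrightarrow> iso_obj \<A> X Y \<Longrightarrow> Y \<in> \<F>\<^sub>1"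
    "\<And>X Y. X \<in> \<T>\<^sub>2 \<Longrightarrow> iso_obj \<C> X Y \<Longrightarrow> Y \<in> \<T>\<^sub>2"
    "\<And>X Y. X \<in> \<F>\<^sub>2 \<Longrightarrow> iso_obj \<C> X Y \<Longrightarrow> Y \<in> \<F>\<^sub>2"
    using tA tC unfolding torsion_pair_def subcategory_def by blast+
  obtain T2 F2 t2 p2 where T2: "T2 \<in> \<T>\<^sub>2" "F2 \<in> \<F>\<^sub>2" and c2: "conflation \<C> T2 (FO j X) F2 t2 p2"
    using tC unfolding torsion_pair_def by blast
  obtain K q where cK: "conflation \<B> (FO jR T2) (FO jR (FO j X)) K (FM jR t2) q"
    using left_exact_functor_inflation[OF jR_left_exact c2] by blast
  obtain W w where cW: "conflation \<B> W X (FO jR (FO j X)) w (un_jR X)"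
    using unit_jR_deflation[OF iR] by blast
  obtain Y y where cY: "conflation \<B> Y X K y (q \<cdot>\<^bsub>\<B>\<^esub> un_jR X)"
    using B.deflation_Comp[OF cW cK] by blast
  note q = B.conflation_mor(2)[OF cK] and t2 = C.conflation_mor(1)[OF c2]
  \<comment> \<open>\<open>K\<close> plays the role of \<open>jR F\<^sub>2\<close>: it is killed by \<open>iR\<close>, and \<open>j K\<close> is isomorphic to \<open>F\<^sub>2\<close>.\<close>
  have iRK: "zero_obj \<A> (FO iR K)"
  proof -
    note c = exact_functor_conflation[OF iR cK]
    obtain r where "inverse_mors \<A> (FO iR (FO jR (FO j X))) (FO iR K) (FM iR q) r"
      using A.zero_cocone_imp_iso[OF c iR_jR_zero] by blast
    then show ?thesis
      using A.zero_obj_iso_obj[OF iR_jR_zero] by (auto simp: A.iso_obj_iff)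
  qed
  note jcK = exact_functor_conflation[OF j_exact cK]
  have jK: "iso_obj \<C> (FO j K) F2"
  proof -
    obtain r r' where "inverse_mors \<C> (FO j (FO jR T2)) T2 (co_jR T2) r"
      "inverse_mors \<C> (FO j (FO jR (FO j X))) (FO j X) (co_jR (FO j X)) r'"
      using j_jR.counit_iso[OF jR_ff] by blast
    then show ?thesis
      using C.cone_iso[OF jcK c2] j_jR.co_natural[OF t2] by metis
  qed
  have jY: "FO j Y \<in> \<T>\<^sub>2"
  proof -
    obtain r where r: "inverse_mors \<C> (FO j X) (FO j (FO jR (FO j X))) (FM j (un_jR X)) r"
      using j_jR.FM_unit_iso[OF jR_ff] by blast
    have "Ident \<C> (FO j K) \<cdot>\<^bsub>\<C>\<^esub> FM j (q \<cdot>\<^bsub>\<B>\<^esub> un_jR X) = FM j q \<cdot>\<^bsub>\<C>\<^esub> FM j (un_jR X)"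
      using C.Ident_left[OF jL_j.R.FM_mor[OF B.Comp_in[OF j_jR.un_mor q]]]
        jL_j.R.FM_Comp[OF j_jR.un_mor q] by simp
    then have "iso_obj \<C> (FO j Y) (FO j (FO jR T2))"
      by (rule C.cocone_iso[OF exact_functor_conflation[OF j_exact cY] jcK r C.inverse_mors_Ident])
    then show ?thesis
      using closed(3)[OF T2(1)] C.iso_obj_trans[OF _ j_jR_iso] C.iso_obj_sym by blast
  qed
  obtain T1 F1 t1 p1 where T1: "T1 \<in> \<T>\<^sub>1" "F1 \<in> \<F>\<^sub>1" and c1: "conflation \<A> T1 (FO iL Y) F1 t1 p1"
    using tA unfolding torsion_pair_def by blast
  obtain W' w' where cW': "conflation \<B> W' Y (FO i (FO iL Y)) w' (un_iL Y)"
    using unit_iL_deflation by blast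
  obtain U u where cU: "conflation \<B> U Y (FO i F1) u (FM i p1 \<cdot>\<^bsub>\<B>\<^esub> un_iL Y)"
    using B.deflation_Comp[OF cW' exact_functor_conflation[OF i_exact c1]] by blast
  note p1 = A.conflation_mor(2)[OF c1]
  have iLU: "FO iL U \<in> \<T>\<^sub>1"
  proof -
    note ip1 = iL_i.R.FM_mor[OF p1]
    obtain r where r: "inverse_mors \<A> (FO iL (FO i F1)) F1 (co_iL F1) r"
      using iL_i.counit_iso[OF i_ff] by blast
    have "co_iL F1 \<cdot>\<^bsub>\<A>\<^esub> FM iL (FM i p1 \<cdot>\<^bsub>\<B>\<^esub> un_iL Y)
      = (co_iL F1 \<cdot>\<^bsub>\<A>\<^esub> FM iL (FM i p1)) \<cdot>\<^bsub>\<A>\<^esub> FM iL (un_iL Y)"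
      using iL_i.L.FM_Comp[OF iL_i.un_mor ip1]
        A.Comp_assoc[OF iL_i.L.FM_mor[OF iL_i.un_mor] iL_i.L.FM_mor[OF ip1] iL_i.co_mor] by simp
    also have "\<dots> = p1 \<cdot>\<^bsub>\<A>\<^esub> (co_iL (FO iL Y) \<cdot>\<^bsub>\<A>\<^esub> FM iL (un_iL Y))"
      using iL_i.co_natural[OF p1]
        A.Comp_assoc[OF iL_i.L.FM_mor[OF iL_i.un_mor] iL_i.co_mor p1] by simp
    also have "\<dots> = p1 \<cdot>\<^bsub>\<A>\<^esub> Ident \<A> (FO iL Y)"
      using iL_i.triangle_left by simp
    finally have "iso_obj \<A> (FO iL U) T1"
      by (rule A.cocone_iso[OF exact_functor_conflation[OF iL cU] c1 A.inverse_mors_Ident r])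
    then show ?thesis
      using closed(1)[OF T1(1)] A.iso_obj_sym by blast
  qed
  have jU: "FO j U \<in> \<T>\<^sub>2"
  proof -
    have "iso_obj \<C> (FO j U) (FO j Y)"
      using C.zero_cone_imp_iso[OF exact_functor_conflation[OF j_exact cU] j_i_zero]
      by (auto simp: C.iso_obj_iff)
    then show ?thesis
      using closed(3)[OF jY] C.iso_obj_sym by blast
  qed
  obtain V v d e where cX: "conflation \<B> U X V (y \<cdot>\<^bsub>\<B>\<^esub> u) v" and cV: "conflation \<B> (FO i F1) V K d e"
    using B.inflation_Comp[OF cU cY] by blast
  have iRV: "FO iR V \<in> \<F>\<^sub>1"
  proof -
    have "iso_obj \<A> (FO iR (FO i F1)) (FO iR V)"
      using A.zero_cone_imp_iso[OF exact_functor_conflation[OF iR cV] iRK]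
      by (auto simp: A.iso_obj_iff)
    then show ?thesis
      using closed(2)[OF T1(2)] A.iso_obj_trans[OF iR_i_iso] by blast
  qed
  have jV: "FO j V \<in> \<F>\<^sub>2"
  proof -
    have "iso_obj \<C> (FO j V) (FO j K)"
      using C.zero_cocone_imp_iso[OF exact_functor_conflation[OF j_exact cV] j_i_zero]
      by (auto simp: C.iso_obj_iff)
    then show ?thesis
      using closed(4)[OF T2(2)] C.iso_obj_trans[OF _ jK] C.iso_obj_sym by blast
  qed
  show ?thesis using cX iLU jU iRV jV by blast
qed

end

lemma subcategory_preimage:
  assumes "additive_cat_functor S T F" and "subcategory T U"
  shows "subcategory S {X. FO F X \<in> U}"
proof -
  interpret additive_cat_functor S T F by fact
  show ?thesis
    using assms(2) FO_iso_obj FO_zero_obj unfolding subcategory_def by blast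
qed

lemma subcategory_Int: "subcategory S U \<Longrightarrow> subcategory S V \<Longrightarrow> subcategory S (U \<inter> V)"
  unfolding subcategory_def by blast

lemma subcategory_eq_ess_image:
  assumes "additive_category S" and "subcategory S U"
    and "\<And>Y. Y \<in> V \<Longrightarrow> FO F Y \<in> U"
    and "\<And>X. X \<in> U \<Longrightarrow> \<exists>Y \<in> V. iso_obj S X (FO F Y)"
  shows "U = ess_image S F V"
  using assms(2-4) additive_category.iso_obj_sym[OF assms(1)]
  unfolding ess_image_def subcategory_def by blast

theorem theorem3p4:
  fixes \<A> :: "('oa, 'ma, 'ea) extcat"
    and \<B> :: "('ob, 'mb, 'eb) extcat"
    and \<C> :: "('oc, 'mc, 'ec) extcat"
    and iL :: "('ob, 'mb, 'oa, 'ma) cfunctor"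
    and i :: "('oa, 'ma, 'ob, 'mb) cfunctor"
    and iR :: "('ob, 'mb, 'oa, 'ma) cfunctor"
    and jL :: "('oc, 'mc, 'ob, 'mb) cfunctor"
    and j :: "('ob, 'mb, 'oc, 'mc) cfunctor"
    and jR :: "('oc, 'mc, 'ob, 'mb) cfunctor"
    and \<T>\<^sub>1 \<F>\<^sub>1 :: "'oa set" and \<T>\<^sub>2 \<F>\<^sub>2 :: "'oc set" and \<T> \<F> :: "'ob set"
  assumes "extriangulated \<A>" and "extriangulated \<B>" and "extriangulated \<C>"
    and "recollement \<A> \<B> \<C> iL i iR jL j jR"
    and "torsion_pair \<A> \<T>\<^sub>1 \<F>\<^sub>1" and "torsion_pair \<C> \<T>\<^sub>2 \<F>\<^sub>2"
    and "\<T> = {X. FO iL X \<in> \<T>\<^sub>1 \<and> FO j X \<in> \<T>\<^sub>2}"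
    and "\<F> = {X. FO iR X \<in> \<F>\<^sub>1 \<and> FO j X \<in> \<F>\<^sub>2}"
  shows "(exact_functor \<B> \<A> iR \<and> exact_functor \<B> \<A> iL \<longrightarrow> torsion_pair \<B> \<T> \<F>) \<and>
    (\<T>\<^sub>1, \<F>\<^sub>1) = (ess_image \<A> iL \<T>, ess_image \<A> iR \<F>) \<and>
    (\<T>\<^sub>2, \<F>\<^sub>2) = (ess_image \<C> j \<T>, ess_image \<C> j \<F>)"
proof -
  have rec: "exact_functor \<A> \<B> i" "exact_functor \<B> \<C> j"
    "right_exact_functor \<B> \<A> iL" "right_exact_functor \<C> \<B> jL"
    "left_exact_functor \<B> \<A> iR" "left_exact_functor \<C> \<B> jR"
    "fully_faithful \<A> \<B> i" "fully_faithful \<C> \<B> jL" "fully_faithful \<C> \<B> jR"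
    and Ker: "ess_image \<B> i UNIV = kernel_objs \<C> j"
    using assms(4) unfolding recollement_def by - (elim conjE, assumption)+
  obtain un_iL co_iL un_iR co_iR un_jL co_jL un_jR co_jR where
    adj: "adjunction \<B> \<A> iL i un_iL co_iL" "adjunction \<A> \<B> i iR un_iR co_iR"
      "adjunction \<C> \<B> jL j un_jL co_jL" "adjunction \<B> \<C> j jR un_jR co_jR"
    and R4: "\<forall>X. \<exists>A h. left_exact_seq4 \<B> (FO i (FO iR X)) X (FO jR (FO j X)) (FO i A)
      (co_iR X) (un_jR X) h"
    and R5: "\<forall>X. \<exists>A' h. right_exact_seq4 \<B> (FO i A') (FO jL (FO j X)) X (FO i (FO iL X))
      h (co_jL X) (un_iL X)"
    using assms(4) unfolding recollement_def by (elim exE conjE) (rule that)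
  interpret A: extriangulated \<A> by fact
  interpret B: extriangulated \<B> by fact
  interpret C: extriangulated \<C> by fact
  have fs: "additive_functor \<A> \<B> i" "additive_functor \<B> \<C> j" "additive_functor \<B> \<A> iL"
    "additive_functor \<C> \<B> jL"
    by (fact rec(1-4)[unfolded exact_functor_def right_exact_functor_def, THEN conjunct1])+
  have fs': "additive_functor (opp \<B>) (opp \<A>) iR" "additive_functor (opp \<C>) (opp \<B>) jR"
    by (fact rec(5,6)[unfolded left_exact_functor_def right_exact_functor_def, THEN conjunct1])+
  note ac = A.additive_category_axioms B.additive_category_axioms C.additive_category_axioms
    A.additive_category_opp B.additive_category_opp C.additive_category_opp
  have F: "additive_cat_functor \<A> \<B> i" "additive_cat_functor \<B> \<C> j"
    "additive_cat_functor \<B> \<A> iL" "additive_cat_functor \<C> \<B> jL"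
    by (intro additive_cat_functor.intro ac fs)+
  have F': "additive_cat_functor (opp \<B>) (opp \<A>) iR" "additive_cat_functor (opp \<C>) (opp \<B>) jR"
    by (intro additive_cat_functor.intro ac fs')+
  note F = F F'[THEN additive_cat_functor.additive_cat_functor_opp, simplified]
  interpret recollement_data \<A> \<B> \<C> iL i iR jL j jR un_iL co_iL un_iR co_iR un_jL co_jL un_jR co_jR
  proof (intro recollement_data.intro recollement_data_axioms.intro adjoint_pair.intro F adj assms)
    show "zero_obj \<C> (FO j (FO i X))" for X
    proof -
      have "FO i X \<in> ess_image \<B> i UNIV"
        using B.inverse_mors_Ident by (auto simp: ess_image_def B.iso_obj_iff)
      then show ?thesis
        unfolding Ker by (simp add: kernel_objs_def)
    qed
  qed (rule rec(1,2,6-9) R4[rule_format] R5[rule_format])+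
  have sub: "subcategory \<A> \<T>\<^sub>1" "subcategory \<A> \<F>\<^sub>1" "subcategory \<C> \<T>\<^sub>2" "subcategory \<C> \<F>\<^sub>2"
    using assms(5,6) by (auto simp: torsion_pair_def)
  have "torsion_pair \<B> \<T> \<F>" if iR: "exact_functor \<B> \<A> iR" and iL: "exact_functor \<B> \<A> iL"
  proof -
    have "subcategory \<B> \<T>" "subcategory \<B> \<F>"
      using subcategory_Int[OF subcategory_preimage[OF F(3) sub(1)] subcategory_preimage[OF F(2) sub(3)]]
        subcategory_Int[OF subcategory_preimage[OF F(5) sub(2)] subcategory_preimage[OF F(2) sub(4)]]
        assms(7,8) by (simp_all add: Collect_conj_eq)
    moreover have "mor \<B> X Y = {zero_mor \<B> X Y}" if "X \<in> \<T>" "Y \<in> \<F>" for X Y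
    proof -
      have "mor \<A> (FO iL X) (FO iR Y) = {zero_mor \<A> (FO iL X) (FO iR Y)}"
        "mor \<C> (FO j X) (FO j Y) = {zero_mor \<C> (FO j X) (FO j Y)}"
        using that assms(5-8) by (auto simp: torsion_pair_def)
      then show ?thesis
        using glued_Hom_zero[OF iR, of X Y] B.zero_mor_in[of X Y] by blast
    qed
    moreover have "\<exists>U \<in> \<T>. \<exists>V \<in> \<F>. \<exists>u v. conflation \<B> U X V u v" for X
      using glued_conflation[OF iR iL assms(5,6), of X] assms(7,8) by blast
    ultimately show ?thesis by (simp add: torsion_pair_def)
  qed
  moreover have "\<T>\<^sub>1 = ess_image \<A> iL \<T>"
  proof (rule subcategory_eq_ess_image[OF ac(1) sub(1)])
    fix X assume "X \<in> \<T>\<^sub>1"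
    then have "FO i X \<in> \<T>"
      using sub(1,3) A.iso_obj_sym[OF iL_i_iso] j_i_zero assms(7) unfolding subcategory_def by blast
    then show "\<exists>Y \<in> \<T>. iso_obj \<A> X (FO iL Y)"
      using A.iso_obj_sym[OF iL_i_iso] by blast
  qed (simp add: assms(7))
  moreover have "\<F>\<^sub>1 = ess_image \<A> iR \<F>"
  proof (rule subcategory_eq_ess_image[OF ac(1) sub(2)])
    fix X assume "X \<in> \<F>\<^sub>1"
    then have "FO i X \<in> \<F>"
      using sub(2,4) iR_i_iso j_i_zero assms(8) unfolding subcategory_def by blast
    then show "\<exists>Y \<in> \<F>. iso_obj \<A> X (FO iR Y)"
      using iR_i_iso by blast
  qed (simp add: assms(8))
  moreover have "\<T>\<^sub>2 = ess_image \<C> j \<T>"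
  proof (rule subcategory_eq_ess_image[OF ac(3) sub(3)])
    fix X assume "X \<in> \<T>\<^sub>2"
    then have "FO jL X \<in> \<T>"
      using sub(1,3) j_jL_iso iL_jL_zero assms(7) unfolding subcategory_def by blast
    then show "\<exists>Y \<in> \<T>. iso_obj \<C> X (FO j Y)"
      using j_jL_iso by blast
  qed (simp add: assms(7))
  moreover have "\<F>\<^sub>2 = ess_image \<C> j \<F>"
  proof (rule subcategory_eq_ess_image[OF ac(3) sub(4)])
    fix X assume "X \<in> \<F>\<^sub>2"
    then have "FO jR X \<in> \<F>"
      using sub(2,4) C.iso_obj_sym[OF j_jR_iso] iR_jR_zero assms(8) unfolding subcategory_def by blast
    then show "\<exists>Y \<in> \<F>. iso_obj \<C> X (FO j Y)"
      using C.iso_obj_sym[OF j_jR_iso] by blast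
  qed (simp add: assms(8))
  ultimately show ?thesis by simp
qed

end
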